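(* Assume the following three conditions. (N$_1$) (i) $\mathcal X_0$ and $\Theta$ are compact. (ii) For each $(x_0,\theta)\in\mathcal X_0\times\Theta$, $f$ admits a $C^J$-supporting function at $(x_0,\theta)$ with $\max_{j=0,\dots,J-1}|c_j(x_0,\theta)|>0$. (iii) There exists a stopping time $\tau$ with $\operatorname{ess\,sup}_\omega\tau<T$ such that the support of the law of $X_\tau$ is contained in the interior $(\mathcal X_0)^o$, and there exist a positive constant $c_0$ and distinct positive numbers $\{\alpha_j\}_{j=0,\dots,J}$ with $\min_j\alpha_j>c_0/2$ such that for every $\xi\in\mathbb S$ and $\varepsilon\in(0,1)$ the sequence $$\Big(1-P\Big[\bigcup_{s\in[\tau,\tau+n^{-c_0}]}\bigcap_{j=0,\dots,J}\bigcup_{t\in[0,n^{-c_0}]}\big\{X_{s+t}-X_s\in\tilde S(\xi,\varepsilon)\text{ and }|\xi\cdot(X_{s+t}-X_s)|=n^{-\alpha_j}\big\}\Big]\Big)_{n\in\mathbb N}$$ belongs to $\mathcal P$. (R) $\varrho\in(0,\infty)$ is a constant such that $\mathbb Q(x,\theta)|\theta-\theta^*|^{-2}\ge|f(x,\theta)|^\varrho$ for all $(x,\theta)\in\hat{\mathcal X}\times\Theta$ with $\theta\ne\theta^*$, and $f(\cdot,\theta)$ is Lipschitz continuous on $\hat{\mathcal X}$ uniformly in $\theta\in\Theta$. (C) There exists $\beta_0>0$ such that the sequence $$\Big(P\Big[\sup_{s,t\in[0,T]:\,X_s\in\hat{\mathcal X},\,t\in[s,s+n^{-1}]}|X_t-X_s|\ge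 n^{-\beta_0}\Big]\Big)_{n\in\mathbb N}$$ belongs to $\mathcal P$. Then for every $L>0$ there exists $c_L>0$ such that $P[\chi_0\le\rho^{-1}]\le c_L\rho^{-L}$ for all $\rho>0$.
   Context: Let $T>0$ and let $X=(X_t)_{t\in[0,T]}$ be a $\mathsf d$-dimensional separable adapted stochastic process on a filtered probability space. $\Theta\subset\mathbb R^{\mathsf p}$ is a set, $\theta^*\in\Theta$, and $\mathcal X_0,\hat{\mathcal X}\subset\mathbb R^{\mathsf d}$ with $\mathcal X_0\subset\hat{\mathcal X}^o$, the interior of $\hat{\mathcal X}$. Let $\mathbb Q:\mathbb R^{\mathsf d}\times\Theta\to[0,\infty)$ and $f:\hat{\mathcal X}\times\Theta\to\mathbb R$ be functions, $J$ a fixed positive integer, and $$\chi_0=\inf_{\theta\in\Theta:\,\theta\ne\theta^*}\frac{\int_0^T\mathbb Q(X_t,\theta)\,dt}{|\theta-\theta^*|^2}.$$ All functions and events appearing are tacitly assumed measurable so that integrals and probabilities make sense. $C^J$-supporting function: $f$ admits a $C^J$-supporting function at $(x_0,\theta_0)$ if there exist a neighborhood $V(x_0,\theta_0)$ of $(x_0,\theta_0)$ in $\mathbb R^{\mathsf d}\times\Theta$, a vector $\xi_0\in\mathbb R^{\mathsf d}$ with $|\xi_0|=1$, and a real function $g$ defined on a neighborhood in $\mathbb R^{\mathsf d}\times\Theta$ of $(P_{\xi_0}x_0,\theta_0)$ containing all $(P_{\xi_0}x,\theta)$ with $(x,\theta)\in V(x_0,\theta_0)$, such that the partial derivatives $\partial_x^jg$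 ($j=0,\dots,J$) exist and are continuous in $(x,\theta)$, and $|f(x,\theta)|\ge|g(P_{\xi_0}x,\theta)|$ for $(x,\theta)\in V(x_0,\theta_0)$. Here $P_{\xi_0}$ is the orthogonal projection onto $\mathbb R\xi_0$. One sets $c_j(x,\theta)=(j!)^{-1}(\partial_x^jg)(P_{\xi_0}x,\theta)[\xi_0^{\otimes j}]$ ($g$ and $c_j$ depend on $(x_0,\theta_0)$). Notation: $\mathbb S=\{\eta\in\mathbb R^{\mathsf d}:|\eta|=1\}$. For $\xi\in\mathbb R^{\mathsf d}\setminus\{0\}$ and $a\in(0,1)$, $C(\xi,a)=\{\eta\in\mathbb R^{\mathsf d}:\eta\cdot\xi\ge(1-a)|\eta||\xi|\}$. $S(\xi,\varepsilon)=C(\xi,\varepsilon)\cap\{\eta:|\eta|\le\varepsilon\}$, $\tilde S(\xi,\varepsilon)=S(\xi,\varepsilon)\cup S(-\xi,\varepsilon)$. In the event in (N$_1$)(iii) only times with $s+t\le T$ are considered (this holds automatically for large $n$). $\mathcal P$ is the set of sequences $(\mathfrak a_n)_{n\in\mathbb N}$ of nonnegative numbers such that for every $L>0$ there is $C_L$ with $\mathfrak a_n\le C_L/n^L$ for all $n\in\mathbb N$. *)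

theory Defs
  imports "HOL-Probability.Probability"
begin

subsection \<open>Sequences decaying faster than every polynomial rate\<close>

text \<open>Sequences are indexed by \<open>n \<ge> 1\<close>; the value at \<open>0\<close> is ignored.\<close>

definition rapid_seqs :: "(nat \<Rightarrow> real) set" where
  "rapid_seqs = {a. (\<forall>n\<ge>1. 0 \<le> a n) \<and>
     (\<forall>L>0. \<exists>C. \<forall>n\<ge>1. a n \<le> C / real n powr L)}"

subsection \<open>Processes and laws\<close>

definition adapted_process ::
  "(real \<Rightarrow> 'a measure) \<Rightarrow> real \<Rightarrow> (real \<Rightarrow> 'a \<Rightarrow> 'b::topological_space) \<Rightarrow> bool" where
  "adapted_process F T X \<longleftrightarrow> (\<forall>t\<in>{0..T}. X t \<in> borel_measurable (F t))"

text \<open>Separability in the sense of Doob, with respect to the class of closed sets.\<close>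

definition separable_process ::
  "'a measure \<Rightarrow> real \<Rightarrow> (real \<Rightarrow> 'a \<Rightarrow> 'b::topological_space) \<Rightarrow> bool" where
  "separable_process M T X \<longleftrightarrow>
     (\<exists>D N. countable D \<and> D \<subseteq> {0..T} \<and> {0..T} \<subseteq> closure D \<and> N \<in> null_sets M \<and>
       (\<forall>\<omega>\<in>space M - N. \<forall>a b A. closed A \<longrightarrow>
          (\<forall>t\<in>D \<inter> {a<..<b}. X t \<omega> \<in> A) \<longrightarrow> (\<forall>t\<in>{0..T} \<inter> {a<..<b}. X t \<omega> \<in> A)))"

definition measure_support :: "'b::topological_space measure \<Rightarrow> 'b set" where
  "measure_support \<mu> = {x. \<forall>U. open U \<and> x \<in> U \<longrightarrow> emeasure \<mu> U > 0}"

subsection \<open>Derivatives in the first variable and supporting functions\<close>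

definition x_partial ::
  "'d::euclidean_space \<Rightarrow> ('d \<times> 'p \<Rightarrow> real) \<Rightarrow> 'd \<times> 'p \<Rightarrow> real" where
  "x_partial b g z = deriv (\<lambda>s. g (fst z + s *\<^sub>R b, snd z)) 0"

primrec x_partials ::
  "'d::euclidean_space list \<Rightarrow> ('d \<times> 'p \<Rightarrow> real) \<Rightarrow> 'd \<times> 'p \<Rightarrow> real" where
  "x_partials [] g = g"
| "x_partials (b # bs) g = x_partial b (x_partials bs g)"

text \<open>All partial derivatives of \<open>g\<close> in the first variable up to order \<open>J\<close> exist on \<open>W\<close> and are
  jointly continuous there.  This is used for \<open>W\<close> relatively open in \<open>UNIV \<times> \<Theta>\<close>, so that the
  derivatives do not depend on the values of \<open>g\<close> outside \<open>W\<close>.\<close>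

definition CJ_in_x ::
  "nat \<Rightarrow> ('d::euclidean_space \<times> 'p::euclidean_space) set \<Rightarrow> ('d \<times> 'p \<Rightarrow> real) \<Rightarrow> bool" where
  "CJ_in_x J W g \<longleftrightarrow>
     (\<forall>bs\<in>lists Basis. length bs < J \<longrightarrow> (\<forall>b\<in>Basis. \<forall>(x, \<theta>)\<in>W.
        (\<lambda>s. x_partials bs g (x + s *\<^sub>R b, \<theta>)) field_differentiable at 0)) \<and>
     (\<forall>bs\<in>lists Basis. length bs \<le> J \<longrightarrow> continuous_on W (x_partials bs g))"

text \<open>The value of the \<open>j\<close>-th derivative tensor of \<open>g\<close> in the first variable at \<open>z\<close> on the
  \<open>j\<close>-fold tensor power of \<open>\<xi>\<close>.\<close>

definition x_tensor ::
  "nat \<Rightarrow> ('d::euclidean_space \<times> 'p \<Rightarrow> real) \<Rightarrow> 'd \<times> 'p \<Rightarrow> 'd \<Rightarrow> real" where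
  "x_tensor j g z \<xi> =
     (\<Sum>bs | set bs \<subseteq> Basis \<and> length bs = j. x_partials bs g z * (\<Prod>b\<leftarrow>bs. \<xi> \<bullet> b))"

definition line_proj :: "'d::euclidean_space \<Rightarrow> 'd \<Rightarrow> 'd" where
  "line_proj \<xi> x = ((x \<bullet> \<xi>) / (\<xi> \<bullet> \<xi>)) *\<^sub>R \<xi>"

definition supp_coeff ::
  "'d::euclidean_space \<Rightarrow> ('d \<times> 'p \<Rightarrow> real) \<Rightarrow> nat \<Rightarrow> 'd \<Rightarrow> 'p \<Rightarrow> real" where
  "supp_coeff \<xi> g j x \<theta> = x_tensor j g (line_proj \<xi> x, \<theta>) \<xi> / fact j"

text \<open>\<open>(\<xi>, g)\<close> is a \<open>C\<^sup>J\<close>-supporting function of \<open>f\<close> at \<open>(x0, \<theta>0)\<close>.  Neighbourhoods are taken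
  relatively open in \<open>UNIV \<times> \<Theta>\<close> (always possible after shrinking), and \<open>V \<subseteq> Xhat \<times> \<Theta>\<close> because
  \<open>f\<close> lives on \<open>Xhat \<times> \<Theta>\<close>.\<close>

definition CJ_supporting ::
  "nat \<Rightarrow> 'd::euclidean_space set \<Rightarrow> 'p::euclidean_space set \<Rightarrow> ('d \<Rightarrow> 'p \<Rightarrow> real) \<Rightarrow>
   'd \<Rightarrow> 'p \<Rightarrow> 'd \<Rightarrow> ('d \<times> 'p \<Rightarrow> real) \<Rightarrow> bool" where
  "CJ_supporting J Xhat \<Theta> f x0 \<theta>0 \<xi> g \<longleftrightarrow> norm \<xi> = 1 \<and>
     (\<exists>V W. openin (top_of_set (UNIV \<times> \<Theta>)) V \<and> (x0, \<theta>0) \<in> V \<and> V \<subseteq> Xhat \<times> \<Theta> \<and>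
        openin (top_of_set (UNIV \<times> \<Theta>)) W \<and> (line_proj \<xi> x0, \<theta>0) \<in> W \<and>
        (\<forall>(x, \<theta>)\<in>V. (line_proj \<xi> x, \<theta>) \<in> W) \<and>
        CJ_in_x J W g \<and>
        (\<forall>(x, \<theta>)\<in>V. \<bar>f x \<theta>\<bar> \<ge> \<bar>g (line_proj \<xi> x, \<theta>)\<bar>))"

subsection \<open>Cones and the events of the nondegeneracy conditions\<close>

definition cone_around :: "'d::euclidean_space \<Rightarrow> real \<Rightarrow> 'd set" where
  "cone_around \<xi> a = {\<eta>. \<eta> \<bullet> \<xi> \<ge> (1 - a) * norm \<eta> * norm \<xi>}"

definition cone_sector :: "'d::euclidean_space \<Rightarrow> real \<Rightarrow> 'd set" where
  "cone_sector \<xi> \<epsilon> = cone_around \<xi> \<epsilon> \<inter> {\<eta>. norm \<eta> \<le> \<epsilon>}"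

definition cone_sector_sym :: "'d::euclidean_space \<Rightarrow> real \<Rightarrow> 'd set" where
  "cone_sector_sym \<xi> \<epsilon> = cone_sector \<xi> \<epsilon> \<union> cone_sector (- \<xi>) \<epsilon>"

definition increment_event ::
  "'a measure \<Rightarrow> real \<Rightarrow> (real \<Rightarrow> 'a \<Rightarrow> 'd::euclidean_space) \<Rightarrow> ('a \<Rightarrow> real) \<Rightarrow> nat \<Rightarrow> real \<Rightarrow>
   (nat \<Rightarrow> real) \<Rightarrow> 'd \<Rightarrow> real \<Rightarrow> nat \<Rightarrow> 'a set" where
  "increment_event M T X \<tau> J c0 \<alpha> \<xi> \<epsilon> n =
     {\<omega>\<in>space M. \<exists>s\<in>{\<tau> \<omega> .. \<tau> \<omega> + real n powr (- c0)}. \<forall>j\<in>{0..J}.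
        \<exists>t\<in>{0 .. real n powr (- c0)}. s + t \<le> T \<and>
          X (s + t) \<omega> - X s \<omega> \<in> cone_sector_sym \<xi> \<epsilon> \<and>
          \<bar>\<xi> \<bullet> (X (s + t) \<omega> - X s \<omega>)\<bar> = real n powr (- \<alpha> j)}"

text \<open>The supremum is taken in the extended reals: it may be \<open>\<infinity>\<close>, and it is \<open>-\<infinity>\<close> if the path
  never visits \<open>Xhat\<close>.\<close>

definition path_osc ::
  "real \<Rightarrow> 'd::euclidean_space set \<Rightarrow> (real \<Rightarrow> 'a \<Rightarrow> 'd) \<Rightarrow> nat \<Rightarrow> 'a \<Rightarrow> ereal" where
  "path_osc T Xhat X n \<omega> =
     (SUP (s, t)\<in>{(s, t). s \<in> {0..T} \<and> t \<in> {0..T} \<and> X s \<omega> \<in> Xhat \<and> t \<in> {s .. s + 1 / real n}}.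
        ereal (norm (X t \<omega> - X s \<omega>)))"

text \<open>Values in \<open>[0, \<infinity>]\<close>: the integral may be infinite, and the infimum is \<open>\<infinity>\<close> if
  \<open>\<Theta> = {\<theta>s}\<close>.\<close>

definition chi0 ::
  "real \<Rightarrow> (real \<Rightarrow> 'a \<Rightarrow> 'd) \<Rightarrow> ('d \<Rightarrow> 'p::euclidean_space \<Rightarrow> real) \<Rightarrow> 'p set \<Rightarrow> 'p \<Rightarrow> 'a \<Rightarrow> ennreal"
  where
  "chi0 T X Q \<Theta> \<theta>s \<omega> =
     (INF \<theta>\<in>{\<theta>\<in>\<Theta>. \<theta> \<noteq> \<theta>s}.
        (\<integral>\<^sup>+ t. ennreal (Q (X t \<omega>) \<theta>) \<partial>lebesgue_on {0..T}) / ennreal ((norm (\<theta> - \<theta>s))\<^sup>2))"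

end

theory Submission
  imports Defs "HOL-Computational_Algebra.Polynomial"
begin

text \<open>
  The bound rests on a deterministic lower bound for \<open>chi0\<close> along a good path.  Fix
  \<open>(x0, \<theta>0) \<in> X0 \<times> \<Theta>\<close>.  Nondegeneracy provides some \<open>k < J\<close> for which the
  \<open>k\<close>-th derivative of the supporting function along \<open>\<xi>\<close> is bounded away from zero near
  \<open>(x0, \<theta>0)\<close>.  The \<open>k\<close>-th divided difference of a function at \<open>k + 1\<close> points is its
  \<open>k\<close>-th derivative at an intermediate point, divided by \<open>k!\<close>
  (\<open>divided_difference_mean_value\<close>).  Hence a function with large \<open>k\<close>-th derivative cannot be
  small at \<open>k + 1\<close> well separated points: at one of them it is at least a constant times the
  \<open>k\<close>-th power of the separation (\<open>large_value_of_large_derivative\<close>).  No Taylor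
  remainder has to be controlled, and the points may lie on either side of the base point.

  On the increment event, the path visits \<open>J + 1\<close> points whose displacements from one base point
  have \<open>\<xi>\<close>-components of absolute values \<open>n powr (- \<alpha> j)\<close>.  As the \<open>\<alpha> j\<close> are distinct,
  these components are separated by a negative power of \<open>n\<close>, whatever their signs.  So
  \<open>\<bar>f (X u) \<theta>\<bar>\<close> exceeds a negative power of \<open>n\<close> at some time \<open>u\<close>.  By Lipschitz
  continuity and the oscillation condition it stays of this order during a time interval whose length
  is again a negative power of \<open>n\<close>, and the lower bound for \<open>Q\<close> turns this into a polynomial
  lower bound for \<open>chi0\<close> (\<open>chi0_ge_on_good_path\<close>).

  Compactness of \<open>X0 \<times> \<Theta>\<close> makes the constants uniform and leaves finitely many directions
  \<open>\<xi>\<close> (\<open>uniform_lower_bound\<close>), so that the good events for all parameters \<open>\<theta>\<close> together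
  fail with rapidly decreasing probability.  The three rates in play are tied to a single integer
  \<open>q\<close>: increments are observed at index \<open>q ^ D\<close>, oscillations at indices \<open>q\<close> and
  \<open>q ^ B\<close>.  A lower bound \<open>1 / q ^ A\<close> for \<open>chi0\<close> at every large \<open>q\<close> then serves all large \<open>\<rho>\<close>
  (\<open>rapid_tail_from_powers\<close>).
\<close>

section \<open>Divided differences and derivatives\<close>

text \<open>Rolle between consecutive zeros.  The last clause keeps the zeros found so far below the
  largest zero of \<open>f\<close>, so that the next zero of \<open>f'\<close>, found beyond it, is new.\<close>

lemma zeros_of_derivative_between_zeros:
  fixes f f' :: "real \<Rightarrow> real"
  assumes "finite Z" and "Z \<subseteq> {a<..<b}"
    and deriv: "\<And>x. x \<in> {a<..<b} \<Longrightarrow> (f has_real_derivative f' x) (at x)"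
    and "\<And>z. z \<in> Z \<Longrightarrow> f z = 0"
  shows "\<exists>Z'. finite Z' \<and> card Z' = card Z - 1 \<and> Z' \<subseteq> {a<..<b} \<and>
    (\<forall>w\<in>Z'. f' w = 0 \<and> (\<exists>z\<in>Z. w < z))"
  using assms(1,2,4)
proof (induction Z rule: finite_linorder_max_induct)
  case empty
  then show ?case by (intro exI[of _ "{}"]) auto
next
  case (insert m A)
  then obtain Z' where Z': "finite Z'" "card Z' = card A - 1" "Z' \<subseteq> {a<..<b}"
    "\<forall>w\<in>Z'. f' w = 0 \<and> (\<exists>z\<in>A. w < z)" by auto
  show ?case
  proof (cases "A = {}")
    case True
    then show ?thesis by (intro exI[of _ "{}"]) auto
  next
    case False
    define l where "l = Max A"
    have l: "l \<in> A" "\<And>z. z \<in> A \<Longrightarrow> z \<le> l" using insert.hyps False by (auto simp: l_def)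
    have lm: "l < m" "a < l" "m < b" using l insert by auto
    have "\<exists>w>l. w < m \<and> f' w = 0"
    proof (rule Rolle_deriv[OF lm(1), of f "\<lambda>x y. f' x * y", THEN exE])
      show "f l = f m" using l insert.prems by auto
      show "continuous_on {l..m} f"
      proof (intro continuous_at_imp_continuous_on ballI)
        fix x assume "x \<in> {l..m}"
        then show "isCont f x" using lm deriv[of x] by (auto intro: DERIV_isCont)
      qed
      show "(f has_derivative (\<lambda>y. f' x * y)) (at x)" if "l < x" "x < m" for x
        using deriv[of x] lm that by (auto simp: has_field_derivative_def)
    next
      fix z assume "l < z \<and> z < m \<and> (\<lambda>y. f' z * y) = (\<lambda>v. 0)"
      then show ?thesis by (metis mult.right_neutral)
    qed
    then obtain w where w: "l < w" "w < m" "f' w = 0" by auto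
    have new: "w \<notin> Z'" using Z'(4) l w by fastforce
    have "card A > 0" using False insert.hyps by auto
    have mA: "m \<notin> A" using insert.hyps by auto
    show ?thesis
    proof (intro exI[of _ "insert w Z'"] conjI)
      show "card (insert w Z') = card (insert m A) - 1"
        using new Z' \<open>card A > 0\<close> mA insert.hyps by simp
      show "\<forall>v\<in>insert w Z'. f' v = 0 \<and> (\<exists>z\<in>insert m A. v < z)" using Z'(4) w(2,3) by blast
      show "insert w Z' \<subseteq> {a<..<b}" using Z'(3) w lm by simp
    qed (simp add: Z')
  qed
qed

lemma generalized_rolle:
  fixes \<phi> :: "nat \<Rightarrow> real \<Rightarrow> real"
  assumes "finite Z" "card Z = Suc k" "Z \<subseteq> {a<..<b}"
    and "\<And>j x. j < k \<Longrightarrow> x \<in> {a<..<b} \<Longrightarrow> (\<phi> j has_real_derivative \<phi> (Suc j) x) (at x)"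
    and "\<And>z. z \<in> Z \<Longrightarrow> \<phi> 0 z = 0"
  shows "\<exists>w\<in>{a<..<b}. \<phi> k w = 0"
  using assms
proof (induction k arbitrary: \<phi> Z)
  case 0
  then have "card Z = 1" by simp
  then obtain z where "Z = {z}" by (rule card_1_singletonE)
  with 0 show ?case by auto
next
  case (Suc k)
  have "\<exists>Z'. finite Z' \<and> card Z' = card Z - 1 \<and> Z' \<subseteq> {a<..<b} \<and>
    (\<forall>w\<in>Z'. \<phi> 1 w = 0 \<and> (\<exists>z\<in>Z. w < z))"
    using Suc.prems by (intro zeros_of_derivative_between_zeros[of Z a b "\<phi> 0"]) auto
  then obtain Z' where "finite Z'" "card Z' = Suc k" "Z' \<subseteq> {a<..<b}" "\<And>w. w \<in> Z' \<Longrightarrow> \<phi> 1 w = 0"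
    using Suc.prems(2) by auto
  then show ?case
    using Suc.IH[of Z' "\<lambda>j. \<phi> (Suc j)"] Suc.prems(4) by auto
qed

lemma coeff_prod_linear_factors:
  fixes Y :: "real set"
  assumes "finite Y"
  shows "degree (\<Prod>y\<in>Y. [:- y, 1:]) = card Y" "coeff (\<Prod>y\<in>Y. [:- y, 1:]) (card Y) = 1"
proof -
  show d: "degree (\<Prod>y\<in>Y. [:- y, 1:]) = card Y"
    by (subst degree_prod_eq_sum_degree) auto
  have "lead_coeff (\<Prod>y\<in>Y. [:- y, 1:]) = 1" by (subst lead_coeff_prod) auto
  then show "coeff (\<Prod>y\<in>Y. [:- y, 1:]) (card Y) = 1" using d by simp
qed

text \<open>The difference of \<open>\<phi> 0\<close> and its Lagrange interpolation polynomial \<open>p\<close> vanishes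
  on \<open>Z\<close>, so its \<open>k\<close>-th derivative has a zero.  There \<open>\<phi> k\<close> agrees with the constant
  \<open>k\<close>-th derivative of \<open>p\<close>, which is \<open>k!\<close> times the leading coefficient, that is, the
  divided difference.\<close>

lemma divided_difference_mean_value:
  fixes \<phi> :: "nat \<Rightarrow> real \<Rightarrow> real"
  assumes Z: "finite Z" "card Z = Suc k" "Z \<subseteq> {a<..<b}"
    and deriv: "\<And>j x. j < k \<Longrightarrow> x \<in> {a<..<b} \<Longrightarrow> (\<phi> j has_real_derivative \<phi> (Suc j) x) (at x)"
  shows "\<exists>w\<in>{a<..<b}. \<phi> k w = fact k * (\<Sum>z\<in>Z. \<phi> 0 z / (\<Prod>y\<in>Z - {z}. z - y))"
proof -
  define l where "l z = (\<Prod>y\<in>Z - {z}. [:- y, 1:])" for z :: real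
  define c where "c z = \<phi> 0 z / (\<Prod>y\<in>Z - {z}. z - y)" for z
  define p where "p = (\<Sum>z\<in>Z. smult (c z) (l z))"
  have cardm: "card (Z - {z}) = k" if "z \<in> Z" for z using that Z by simp
  have "degree (l z) \<le> k" if "z \<in> Z" for z
    using coeff_prod_linear_factors(1)[of "Z - {z}"] cardm[OF that] Z(1) by (simp add: l_def)
  then have deg: "degree p \<le> k"
    unfolding p_def using degree_smult_le order_trans by (intro degree_sum_le Z(1)) blast
  have "coeff (l z) k = 1" if "z \<in> Z" for z
    using coeff_prod_linear_factors(2)[of "Z - {z}"] cardm[OF that] Z(1) by (simp add: l_def)
  then have coeff: "coeff p k = (\<Sum>z\<in>Z. c z)"
    unfolding p_def by (simp add: coeff_sum)
  have interp: "poly p z = \<phi> 0 z" if "z \<in> Z" for z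
  proof -
    have lx: "poly (l x) z = (if x = z then (\<Prod>y\<in>Z - {z}. z - y) else 0)" if "x \<in> Z" for x
      using that \<open>z \<in> Z\<close> Z(1) unfolding l_def poly_prod by auto
    have "poly p z = (\<Sum>x\<in>Z. if x = z then c x * (\<Prod>y\<in>Z - {z}. z - y) else 0)"
      unfolding p_def poly_sum by (intro sum.cong) (auto simp: lx)
    also have "\<dots> = c z * (\<Prod>y\<in>Z - {z}. z - y)" using that Z(1) by simp
    also have "\<dots> = \<phi> 0 z" using Z(1) by (simp add: c_def)
    finally show ?thesis .
  qed
  have "\<exists>w\<in>{a<..<b}. \<phi> k w - poly ((pderiv ^^ k) p) w = 0"
  proof (rule generalized_rolle[OF Z, where \<phi> = "\<lambda>j x. \<phi> j x - poly ((pderiv ^^ j) p) x"])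
    show "((\<lambda>x. \<phi> j x - poly ((pderiv ^^ j) p) x) has_real_derivative
      \<phi> (Suc j) x - poly ((pderiv ^^ Suc j) p) x) (at x)" if "j < k" "x \<in> {a<..<b}" for j x
      using DERIV_diff[OF deriv[OF that] poly_DERIV] by simp
  qed (simp add: interp)
  then obtain w where w: "w \<in> {a<..<b}" "\<phi> k w = poly ((pderiv ^^ k) p) w" by auto
  have "degree ((pderiv ^^ k) p) = 0" using deg by (simp add: degree_higher_pderiv)
  then obtain d where "(pderiv ^^ k) p = [:d:]" by (rule degree_eq_zeroE)
  then have "poly ((pderiv ^^ k) p) w = coeff ((pderiv ^^ k) p) 0" by simp
  also have "\<dots> = fact k * coeff p k"
    by (simp add: coeff_higher_pderiv pochhammer_fact)
  finally show ?thesis using w coeff by (auto simp: c_def)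
qed

section \<open>Derivatives along a direction\<close>

lemma derivative_along_line:
  fixes G :: "'a::real_normed_vector \<Rightarrow> real"
  assumes "((\<lambda>s. G ((y + r *\<^sub>R w) + s *\<^sub>R w)) has_real_derivative D) (at 0)"
  shows "((\<lambda>s. G (y + s *\<^sub>R w)) has_real_derivative D) (at r)"
proof -
  have "((\<lambda>s. G (y + (s + r) *\<^sub>R w)) has_real_derivative D) (at 0)"
    using assms by (simp add: algebra_simps)
  then show ?thesis using DERIV_shift[of "\<lambda>s. G (y + s *\<^sub>R w)" D 0 r] by simp
qed

text \<open>Split the increment into a step along \<open>w\<close> after a step along \<open>v\<close>.  The second step
  has base point \<open>x + h *\<^sub>R v\<close>, which moves with \<open>h\<close>; the mean value theorem and continuity of
  \<open>Dw\<close> bring it back to \<open>x\<close>.\<close>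

lemma directional_derivative_add:
  fixes G :: "'a::real_normed_vector \<Rightarrow> real"
  assumes "open S" "x \<in> S"
    and v: "((\<lambda>s. G (x + s *\<^sub>R v)) has_real_derivative Dv) (at 0)"
    and w: "\<And>x. x \<in> S \<Longrightarrow> ((\<lambda>s. G (x + s *\<^sub>R w)) has_real_derivative Dw x) (at 0)"
    and cont: "continuous_on S Dw"
  shows "((\<lambda>s. G (x + s *\<^sub>R (v + w))) has_real_derivative Dv + Dw x) (at 0)"
proof -
  have "((\<lambda>h. (G (x + h *\<^sub>R (v + w)) - G (x + h *\<^sub>R v)) / h) \<longlongrightarrow> Dw x) (at 0)"
  proof (rule LIM_I)
    fix r :: real assume "r > 0"
    have "isCont Dw x" using cont assms(1,2) by (simp add: continuous_on_eq_continuous_at)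
    then obtain d1 where d1: "d1 > 0" "\<And>y. dist y x < d1 \<Longrightarrow> dist (Dw y) (Dw x) < r"
      using \<open>r > 0\<close> unfolding continuous_at_eps_delta by metis
    obtain d2 where d2: "d2 > 0" "ball x d2 \<subseteq> S" using assms(1,2) openE by blast
    define d where "d = min d1 d2"
    have d: "d > 0" "\<And>y. dist y x < d \<Longrightarrow> y \<in> S \<and> \<bar>Dw y - Dw x\<bar> < r"
      using d1 d2 by (auto simp: d_def dist_real_def dist_commute subset_iff)
    define s where "s = d / (norm v + norm w + 1)"
    have pos: "norm v + norm w + 1 > 0" by (simp add: add_nonneg_pos)
    have "s > 0" using d(1) pos by (simp add: s_def)
    moreover have "norm ((G (x + h *\<^sub>R (v + w)) - G (x + h *\<^sub>R v)) / h - Dw x) < r"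
      if h: "h \<noteq> 0 \<and> norm (h - 0) < s" for h
    proof -
      have near: "dist (x + h *\<^sub>R v + (t * h) *\<^sub>R w) x < d" if "0 \<le> t" "t \<le> 1" for t
      proof -
        have "norm (h *\<^sub>R v + (t * h) *\<^sub>R w) \<le> \<bar>h\<bar> * norm v + \<bar>t * h\<bar> * norm w"
          by (metis norm_scaleR norm_triangle_ineq)
        also have "\<bar>t * h\<bar> * norm w \<le> \<bar>h\<bar> * norm w"
          using that by (intro mult_right_mono) (auto simp: abs_mult mult_left_le_one_le)
        finally have "norm (h *\<^sub>R v + (t * h) *\<^sub>R w) \<le> \<bar>h\<bar> * (norm v + norm w)"
          by (simp add: algebra_simps)
        also have "\<dots> \<le> \<bar>h\<bar> * (norm v + norm w + 1)" by (simp add: mult_left_mono)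
        also have "\<dots> < s * (norm v + norm w + 1)" using h pos by (intro mult_strict_right_mono) auto
        also have "\<dots> = d" using pos by (simp add: s_def)
        finally show ?thesis by (simp add: dist_norm add.assoc)
      qed
      have der: "((\<lambda>t. G (x + h *\<^sub>R v + (t * h) *\<^sub>R w)) has_real_derivative
        Dw (x + h *\<^sub>R v + (t * h) *\<^sub>R w) * h) (at t)" if "0 \<le> t" "t \<le> 1" for t
      proof -
        have "((\<lambda>s. G (x + h *\<^sub>R v + s *\<^sub>R w)) has_real_derivative
            Dw (x + h *\<^sub>R v + (t * h) *\<^sub>R w)) (at (t * h))"
          using d(2) near[OF that] derivative_along_line[where G = G, OF w] by blast
        moreover have "((\<lambda>t. t * h) has_real_derivative h) (at t)"
          by (auto intro!: derivative_eq_intros)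
        ultimately show ?thesis by (rule DERIV_chain2)
      qed
      obtain t where t: "0 < t" "t < 1"
        "G (x + h *\<^sub>R v + (1 * h) *\<^sub>R w) - G (x + h *\<^sub>R v + (0 * h) *\<^sub>R w)
          = (1 - 0) * (Dw (x + h *\<^sub>R v + (t * h) *\<^sub>R w) * h)"
        using MVT2[of 0 1 "\<lambda>t. G (x + h *\<^sub>R v + (t * h) *\<^sub>R w)"
            "\<lambda>t. Dw (x + h *\<^sub>R v + (t * h) *\<^sub>R w) * h"] der by auto
      then have "(G (x + h *\<^sub>R (v + w)) - G (x + h *\<^sub>R v)) / h = Dw (x + h *\<^sub>R v + (t * h) *\<^sub>R w)"
        using h by (simp add: scaleR_add_right add.assoc)
      then show ?thesis using d(2) near[of t] t by simp
    qed
    ultimately show "\<exists>s>0. \<forall>h. h \<noteq> 0 \<and> norm (h - 0) < s \<longrightarrow>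
      norm ((G (x + h *\<^sub>R (v + w)) - G (x + h *\<^sub>R v)) / h - Dw x) < r" by blast
  qed
  moreover have "((\<lambda>h. (G (x + h *\<^sub>R v) - G x) / h) \<longlongrightarrow> Dv) (at 0)"
    using v by (simp add: DERIV_def)
  ultimately have "((\<lambda>h. (G (x + h *\<^sub>R v) - G x) / h + (G (x + h *\<^sub>R (v + w)) - G (x + h *\<^sub>R v)) / h)
      \<longlongrightarrow> Dv + Dw x) (at 0)" by (intro tendsto_add)
  then show ?thesis by (simp add: DERIV_def diff_divide_distrib)
qed

lemma directional_derivative_sum:
  fixes G :: "'a::real_normed_vector \<Rightarrow> real"
  assumes "finite B" "open S"
    and D: "\<And>b x. b \<in> B \<Longrightarrow> x \<in> S \<Longrightarrow> ((\<lambda>s. G (x + s *\<^sub>R b)) has_real_derivative D b x) (at 0)"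
    and cont: "\<And>b. b \<in> B \<Longrightarrow> continuous_on S (D b)"
    and "x \<in> S"
  shows "((\<lambda>s. G (x + s *\<^sub>R (\<Sum>b\<in>B. a b *\<^sub>R b))) has_real_derivative (\<Sum>b\<in>B. a b * D b x)) (at 0)"
  using assms(1) D cont
proof (induction B rule: finite_induct)
  case empty
  then show ?case by simp
next
  case (insert b B)
  have "((\<lambda>s. G (y + s *\<^sub>R (a b *\<^sub>R b))) has_real_derivative a b * D b y) (at 0)" if "y \<in> S" for y
  proof -
    have "((\<lambda>s. G (y + s *\<^sub>R b)) has_real_derivative D b y) (at (0 * a b))"
      using insert.prems(1)[of b y] that by simp
    moreover have "((\<lambda>s. s * a b) has_real_derivative a b) (at 0)"
      by (auto intro!: derivative_eq_intros)
    ultimately show ?thesis using DERIV_chain2[of "\<lambda>s. G (y + s *\<^sub>R b)" "D b y" "\<lambda>s. s * a b" 0 "a b"]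
      by (simp add: mult.commute)
  qed
  moreover have "continuous_on S (\<lambda>y. a b * D b y)"
    using insert.prems(2)[of b] by (intro continuous_intros) auto
  moreover have "((\<lambda>s. G (x + s *\<^sub>R (\<Sum>b\<in>B. a b *\<^sub>R b))) has_real_derivative (\<Sum>b\<in>B. a b * D b x)) (at 0)"
    using insert.IH insert.prems by simp
  ultimately have "((\<lambda>s. G (x + s *\<^sub>R ((\<Sum>b\<in>B. a b *\<^sub>R b) + a b *\<^sub>R b))) has_real_derivative
      (\<Sum>b\<in>B. a b * D b x) + a b * D b x) (at 0)"
    using assms(2) \<open>x \<in> S\<close> by (intro directional_derivative_add[where S = S]) auto
  then show ?case using insert.hyps by (simp add: add.commute)
qed

text \<open>Singles out the derivative applied last, the head of the list: this is the form in which the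
  derivative of the \<open>j\<close>-th tensor along \<open>\<xi>\<close> appears.\<close>

lemma x_tensor_Suc:
  "x_tensor (Suc j) g z \<xi> = (\<Sum>bs | set bs \<subseteq> Basis \<and> length bs = j.
     (\<Sum>b\<in>Basis. (\<xi> \<bullet> b) * x_partials (b # bs) g z) * (\<Prod>b\<leftarrow>bs. \<xi> \<bullet> b))"
proof -
  let ?L = "{bs. set bs \<subseteq> Basis \<and> length bs = j}"
  have inj: "inj_on (\<lambda>(bs, b). b # bs) (?L \<times> Basis)" by (auto simp: inj_on_def)
  have "x_tensor (Suc j) g z \<xi> =
     (\<Sum>(bs, b)\<in>?L \<times> Basis. x_partials (b # bs) g z * (\<Prod>b\<leftarrow>b # bs. \<xi> \<bullet> b))"
    unfolding x_tensor_def lists_length_Suc_eq sum.reindex[OF inj] by (simp add: case_prod_unfold)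
  also have "\<dots> = (\<Sum>bs\<in>?L. \<Sum>b\<in>Basis. x_partials (b # bs) g z * (\<Prod>b\<leftarrow>b # bs. \<xi> \<bullet> b))"
    by (rule sum.cartesian_product[symmetric])
  also have "\<dots> = (\<Sum>bs\<in>?L. (\<Sum>b\<in>Basis. (\<xi> \<bullet> b) * x_partials (b # bs) g z) * (\<Prod>b\<leftarrow>bs. \<xi> \<bullet> b))"
    by (simp add: sum_distrib_left sum_distrib_right mult_ac)
  finally show ?thesis .
qed

lemma continuous_on_x_tensor:
  assumes "CJ_in_x J W g" "j \<le> J"
  shows "continuous_on W (\<lambda>z. x_tensor j g z \<xi>)"
  using assms unfolding x_tensor_def CJ_in_x_def
  by (intro continuous_on_sum continuous_on_mult continuous_on_const) (auto simp: lists_eq_set)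

lemma open_slice:
  fixes W :: "('a::topological_space \<times> 'b::topological_space) set"
  assumes "openin (top_of_set (UNIV \<times> \<Theta>)) W" "\<theta> \<in> \<Theta>"
  shows "open {x. (x, \<theta>) \<in> W}"
proof -
  obtain U where U: "open U" "W = (UNIV \<times> \<Theta>) \<inter> U" using assms(1) by (auto simp: openin_open)
  then have "{x. (x, \<theta>) \<in> W} = (\<lambda>x. (x, \<theta>)) -` U" using assms(2) by auto
  moreover have "open ((\<lambda>x. (x, \<theta>)) -` U)"
    using U(1) by (intro open_vimage continuous_on_Pair continuous_on_const continuous_on_id)
  ultimately show ?thesis by simp
qed

text \<open>Along the line through \<open>x\<close> in direction \<open>\<xi>\<close>, the functions
  \<open>x_tensor j g (_, \<theta>) \<xi>\<close> are the successive derivatives of \<open>g\<close>.  This makes the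
  one-dimensional mean value theorem for divided differences applicable.\<close>

lemma x_tensor_has_derivative:
  fixes g :: "'d::euclidean_space \<times> 'p::euclidean_space \<Rightarrow> real"
  assumes C: "CJ_in_x J W g" and W: "openin (top_of_set (UNIV \<times> \<Theta>)) W"
    and "(x, \<theta>) \<in> W" "j < J"
  shows "((\<lambda>s. x_tensor j g (x + s *\<^sub>R \<xi>, \<theta>) \<xi>) has_real_derivative x_tensor (Suc j) g (x, \<theta>) \<xi>) (at 0)"
proof -
  define S where "S = {x. (x, \<theta>) \<in> W}"
  have "\<theta> \<in> \<Theta>" using assms(3) openin_imp_subset[OF W] by auto
  then have S: "open S" "x \<in> S" using open_slice[OF W] assms(3) by (auto simp: S_def)
  have "((\<lambda>s. x_partials bs g (x + s *\<^sub>R \<xi>, \<theta>)) has_real_derivative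
      (\<Sum>b\<in>Basis. (\<xi> \<bullet> b) * x_partials (b # bs) g (x, \<theta>))) (at 0)"
    if bs: "set bs \<subseteq> Basis" "length bs = j" for bs
  proof -
    have "((\<lambda>s. x_partials bs g (x + s *\<^sub>R (\<Sum>b\<in>Basis. (\<xi> \<bullet> b) *\<^sub>R b), \<theta>)) has_real_derivative
      (\<Sum>b\<in>Basis. (\<xi> \<bullet> b) * x_partials (b # bs) g (x, \<theta>))) (at 0)"
    proof (rule directional_derivative_sum[OF finite_Basis S(1) _ _ S(2), where G = "\<lambda>x. x_partials bs g (x, \<theta>)"])
      fix b y assume b: "b \<in> (Basis :: 'd set)"
      show "((\<lambda>s. x_partials bs g (y + s *\<^sub>R b, \<theta>)) has_real_derivative x_partials (b # bs) g (y, \<theta>)) (at 0)"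
        if "y \<in> S"
      proof -
        have "(\<lambda>s. x_partials bs g (y + s *\<^sub>R b, \<theta>)) field_differentiable at 0"
          using C bs b \<open>j < J\<close> that unfolding CJ_in_x_def S_def lists_eq_set by fastforce
        then show ?thesis by (simp add: x_partial_def DERIV_deriv_iff_field_differentiable)
      qed
      have "continuous_on W (x_partials (b # bs) g)"
        using C bs b \<open>j < J\<close> unfolding CJ_in_x_def lists_eq_set
        by (metis (mono_tags, lifting) Suc_leI insert_subset length_Cons list.simps(15) mem_Collect_eq)
      then show "continuous_on S (\<lambda>y. x_partials (b # bs) g (y, \<theta>))"
        by (rule continuous_on_compose2) (use S_def in \<open>auto intro: continuous_on_Pair continuous_on_id continuous_on_const\<close>)
    qed
    then show ?thesis by (simp only: euclidean_representation)
  qed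
  then show ?thesis
    unfolding x_tensor_Suc unfolding x_tensor_def
    by (intro DERIV_sum DERIV_cmult_right) auto
qed

section \<open>Lower bounds from supporting functions\<close>

text \<open>This is all that is retained from a supporting function.  The exponent is \<open>J\<close> rather
  than the order \<open>k < J\<close> of the nonvanishing derivative because \<open>k\<close> varies with the point,
  while a compactness argument needs a bound of one fixed form.\<close>

definition large_on_spread ::
  "nat \<Rightarrow> ('d::real_inner \<Rightarrow> real) \<Rightarrow> 'd \<Rightarrow> real \<Rightarrow> real \<Rightarrow> 'd \<Rightarrow> bool" where
  "large_on_spread J \<phi> \<xi> r c x \<longleftrightarrow>
     (\<forall>Y \<sigma>. (\<forall>i\<le>J. dist (Y i) x < r) \<longrightarrow> 0 < \<sigma> \<longrightarrow> \<sigma> \<le> 1 \<longrightarrow>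
        (\<forall>i\<le>J. \<forall>j\<le>J. i \<noteq> j \<longrightarrow> \<sigma> \<le> \<bar>\<xi> \<bullet> Y i - \<xi> \<bullet> Y j\<bar>) \<longrightarrow>
        (\<exists>i\<le>J. c * \<sigma> ^ J \<le> \<bar>\<phi> (Y i)\<bar>))"

text \<open>If \<open>\<phi> 0\<close> were small on all of \<open>Z\<close>, each term of the divided difference, whose
  denominator is at least \<open>\<sigma> ^ k\<close>, would be small, and the \<open>k + 1\<close> terms together could not
  reach \<open>\<delta> / k!\<close>.\<close>

lemma large_value_of_large_derivative:
  fixes \<phi> :: "nat \<Rightarrow> real \<Rightarrow> real"
  assumes Z: "finite Z" "card Z = Suc k" "Z \<subseteq> {a<..<b}"
    and deriv: "\<And>j x. j < k \<Longrightarrow> x \<in> {a<..<b} \<Longrightarrow> (\<phi> j has_real_derivative \<phi> (Suc j) x) (at x)"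
    and large: "\<And>x. x \<in> {a<..<b} \<Longrightarrow> \<delta> \<le> \<bar>\<phi> k x\<bar>"
    and sep: "0 < \<sigma>" "\<And>y z. y \<in> Z \<Longrightarrow> z \<in> Z \<Longrightarrow> y \<noteq> z \<Longrightarrow> \<sigma> \<le> \<bar>y - z\<bar>"
  shows "\<exists>z\<in>Z. \<delta> / fact (Suc k) * \<sigma> ^ k \<le> \<bar>\<phi> 0 z\<bar>"
proof (rule ccontr)
  assume "\<not> ?thesis"
  then have small: "\<bar>\<phi> 0 z\<bar> < \<delta> / fact (Suc k) * \<sigma> ^ k" if "z \<in> Z" for z
    using that by (auto simp: not_le)
  obtain w where w: "w \<in> {a<..<b}" "\<phi> k w = fact k * (\<Sum>z\<in>Z. \<phi> 0 z / (\<Prod>y\<in>Z - {z}. z - y))"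
    using divided_difference_mean_value[where \<phi> = \<phi>, OF Z deriv] by blast
  have "\<bar>\<phi> 0 z / (\<Prod>y\<in>Z - {z}. z - y)\<bar> < \<delta> / fact (Suc k)" if "z \<in> Z" for z
  proof -
    have "(\<Prod>y\<in>Z - {z}. \<sigma>) \<le> (\<Prod>y\<in>Z - {z}. \<bar>z - y\<bar>)"
      using sep that by (intro prod_mono) auto
    moreover have "card (Z - {z}) = k" using that Z by simp
    ultimately have P: "\<sigma> ^ k \<le> \<bar>\<Prod>y\<in>Z - {z}. z - y\<bar>" by (simp add: abs_prod)
    have \<sigma>k: "\<sigma> ^ k > 0" using sep(1) by simp
    have "\<bar>\<phi> 0 z / (\<Prod>y\<in>Z - {z}. z - y)\<bar> = \<bar>\<phi> 0 z\<bar> / \<bar>\<Prod>y\<in>Z - {z}. z - y\<bar>" by simp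
    also have "\<dots> \<le> \<bar>\<phi> 0 z\<bar> / \<sigma> ^ k" using P \<sigma>k by (intro divide_left_mono) auto
    also have "\<dots> < \<delta> / fact (Suc k)" using small[OF that] \<sigma>k by (simp add: pos_divide_less_eq)
    finally show ?thesis .
  qed
  moreover have "Z \<noteq> {}" using Z(2) by auto
  ultimately have "(\<Sum>z\<in>Z. \<bar>\<phi> 0 z / (\<Prod>y\<in>Z - {z}. z - y)\<bar>) < (\<Sum>z\<in>Z. \<delta> / fact (Suc k))"
    using Z(1) by (intro sum_strict_mono) auto
  also have "\<dots> = \<delta> / fact k" using Z(2) by (simp add: field_simps del: of_nat_Suc)
  finally have "\<bar>\<Sum>z\<in>Z. \<phi> 0 z / (\<Prod>y\<in>Z - {z}. z - y)\<bar> < \<delta> / fact k"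
    using sum_abs[of "\<lambda>z. \<phi> 0 z / (\<Prod>y\<in>Z - {z}. z - y)" Z] by simp
  then have "\<bar>\<phi> k w\<bar> < \<delta>" using w(2) by (simp add: abs_mult pos_less_divide_eq mult.commute)
  with large[OF w(1)] show False by simp
qed

lemma x_tensor_0: "x_tensor 0 g z \<xi> = g z" for \<xi> :: "'d::euclidean_space"
proof -
  have "{bs. set bs \<subseteq> Basis \<and> length bs = 0} = {[] :: 'd list}" by auto
  then show ?thesis by (simp add: x_tensor_def)
qed

text \<open>Choose \<open>k\<close> with nonvanishing \<open>k\<close>-th coefficient.  By joint continuity that derivative
  stays above half of its value near the base point, uniformly in \<open>\<theta>\<close>; the points
  \<open>\<xi> \<bullet> Y i\<close> with \<open>i \<le> k\<close> then suffice.\<close>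

lemma supporting_function_lower_bound:
  fixes f :: "'d::euclidean_space \<Rightarrow> 'p::euclidean_space \<Rightarrow> real"
  assumes supp: "CJ_supporting J Xhat \<Theta> f x0 \<theta>0 \<xi> g"
    and nondeg: "Max ((\<lambda>j. \<bar>supp_coeff \<xi> g j x0 \<theta>0\<bar>) ` {0..J - 1}) > 0" and J: "J > 0"
  shows "\<exists>r>0. \<exists>c>0. \<forall>\<theta>\<in>\<Theta>. dist \<theta> \<theta>0 < r \<longrightarrow> large_on_spread J (\<lambda>x. f x \<theta>) \<xi> r c x0"
proof -
  from supp obtain V W where \<xi>: "norm \<xi> = 1"
    and V: "openin (top_of_set (UNIV \<times> \<Theta>)) V" "(x0, \<theta>0) \<in> V"
    and W: "openin (top_of_set (UNIV \<times> \<Theta>)) W" "(line_proj \<xi> x0, \<theta>0) \<in> W"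
    and g: "CJ_in_x J W g" and fg: "\<And>x \<theta>. (x, \<theta>) \<in> V \<Longrightarrow> \<bar>g (line_proj \<xi> x, \<theta>)\<bar> \<le> \<bar>f x \<theta>\<bar>"
    unfolding CJ_supporting_def by fast
  have proj: "line_proj \<xi> x = (\<xi> \<bullet> x) *\<^sub>R \<xi>" for x
    using \<xi> by (simp add: line_proj_def dot_square_norm inner_commute)
  define z0 where "z0 = (line_proj \<xi> x0, \<theta>0)"
  have "Max ((\<lambda>j. \<bar>supp_coeff \<xi> g j x0 \<theta>0\<bar>) ` {0..J - 1}) \<in> (\<lambda>j. \<bar>supp_coeff \<xi> g j x0 \<theta>0\<bar>) ` {0..J - 1}"
    by (rule Max_in) auto
  then obtain k where "k \<le> J - 1" "\<bar>supp_coeff \<xi> g k x0 \<theta>0\<bar> > 0"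
    using nondeg by (metis (no_types, lifting) atLeastAtMost_iff imageE)
  then have k: "k < J" "x_tensor k g z0 \<xi> \<noteq> 0" using J by (auto simp: supp_coeff_def z0_def)
  define \<delta> where "\<delta> = \<bar>x_tensor k g z0 \<xi>\<bar> / 2"
  have \<delta>: "\<delta> > 0" using k(2) by (simp add: \<delta>_def)
  define U where "U = W \<inter> (\<lambda>z. x_tensor k g z \<xi>) -` {y. \<delta> < \<bar>y\<bar>}"
  have "open {y::real. \<delta> < \<bar>y\<bar>}" by (intro open_Collect_less continuous_intros)
  then have "openin (top_of_set W) U"
    unfolding U_def using k(1) by (intro continuous_openin_preimage_gen continuous_on_x_tensor[OF g]) auto
  then have U: "openin (top_of_set (UNIV \<times> \<Theta>)) U" using W(1) openin_trans by blast
  have "z0 \<in> U" using W(2) \<delta> by (auto simp: U_def z0_def \<delta>_def)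
  then obtain e1 where e1: "e1 > 0" "ball z0 e1 \<inter> (UNIV \<times> \<Theta>) \<subseteq> U"
    using U unfolding openin_contains_ball by blast
  obtain e2 where e2: "e2 > 0" "ball (x0, \<theta>0) e2 \<inter> (UNIV \<times> \<Theta>) \<subseteq> V"
    using V unfolding openin_contains_ball by blast
  define r where "r = min e1 e2 / 2"
  have near: "(y, \<theta>) \<in> ball (y0, \<theta>0) (min e1 e2)" if "dist y y0 < r" "dist \<theta> \<theta>0 < r"
    for y y0 :: 'd and \<theta>
  proof -
    have "dist (y0, \<theta>0) (y, \<theta>) \<le> dist y y0 + dist \<theta> \<theta>0"
      unfolding dist_Pair_Pair by (metis dist_commute real_sqrt_sum_squares_triangle_ineq sqrt_sum_squares_le_sum zero_le_dist)
    then show ?thesis using that by (simp add: r_def)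
  qed
  have "large_on_spread J (\<lambda>x. f x \<theta>) \<xi> r (\<delta> / fact (Suc k)) x0" if \<theta>: "\<theta> \<in> \<Theta>" "dist \<theta> \<theta>0 < r" for \<theta>
    unfolding large_on_spread_def
  proof (intro allI impI)
    fix Y :: "nat \<Rightarrow> 'd" and \<sigma> :: real
    assume Y: "\<forall>i\<le>J. dist (Y i) x0 < r" and \<sigma>: "0 < \<sigma>" "\<sigma> \<le> 1"
      and sep: "\<forall>i\<le>J. \<forall>j\<le>J. i \<noteq> j \<longrightarrow> \<sigma> \<le> \<bar>\<xi> \<bullet> Y i - \<xi> \<bullet> Y j\<bar>"
    define u where "u i = \<xi> \<bullet> Y i" for i
    define I where "I = {\<xi> \<bullet> x0 - r<..<\<xi> \<bullet> x0 + r}"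
    have inU: "(v *\<^sub>R \<xi>, \<theta>) \<in> U" if "v \<in> I" for v
    proof -
      have "v *\<^sub>R \<xi> - (\<xi> \<bullet> x0) *\<^sub>R \<xi> = (v - \<xi> \<bullet> x0) *\<^sub>R \<xi>" by (simp add: algebra_simps)
      then have "dist (v *\<^sub>R \<xi>) (line_proj \<xi> x0) < r"
        using that \<xi> by (auto simp: dist_norm proj I_def)
      from near[OF this \<theta>(2)] show ?thesis using e1(2) \<theta>(1) by (auto simp: z0_def)
    qed
    have uI: "u i \<in> I" if "i \<le> J" for i
    proof -
      have "\<bar>\<xi> \<bullet> (Y i - x0)\<bar> \<le> norm \<xi> * norm (Y i - x0)" by (rule Cauchy_Schwarz_ineq2)
      then have "\<bar>u i - \<xi> \<bullet> x0\<bar> < r" using Y that \<xi> by (auto simp: u_def dist_norm inner_diff_right intro: le_less_trans)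
      then show ?thesis by (auto simp: I_def)
    qed
    have inj: "inj_on u {..k}"
    proof (rule inj_onI, rule ccontr)
      fix i j assume *: "i \<in> {..k}" "j \<in> {..k}" "u i = u j" "i \<noteq> j"
      then have "\<sigma> \<le> \<bar>\<xi> \<bullet> Y i - \<xi> \<bullet> Y j\<bar>" using sep k(1) by simp
      then show False using * \<sigma>(1) by (simp add: u_def)
    qed
    have "\<exists>z\<in>u ` {..k}. \<delta> / fact (Suc k) * \<sigma> ^ k \<le> \<bar>x_tensor 0 g (z *\<^sub>R \<xi>, \<theta>) \<xi>\<bar>"
    proof (rule large_value_of_large_derivative[where \<phi> = "\<lambda>j v. x_tensor j g (v *\<^sub>R \<xi>, \<theta>) \<xi>"
          and a = "\<xi> \<bullet> x0 - r" and b = "\<xi> \<bullet> x0 + r"])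
      show "finite (u ` {..k})" by simp
      show "card (u ` {..k}) = Suc k" using card_image[OF inj] by simp
      show "u ` {..k} \<subseteq> {\<xi> \<bullet> x0 - r<..<\<xi> \<bullet> x0 + r}" using uI k(1) by (auto simp: I_def)
      show "\<delta> \<le> \<bar>x_tensor k g (v *\<^sub>R \<xi>, \<theta>) \<xi>\<bar>" if "v \<in> {\<xi> \<bullet> x0 - r<..<\<xi> \<bullet> x0 + r}" for v
        using inU[of v] that by (auto simp: U_def I_def)
      show "((\<lambda>v. x_tensor j g (v *\<^sub>R \<xi>, \<theta>) \<xi>) has_real_derivative x_tensor (Suc j) g (v *\<^sub>R \<xi>, \<theta>) \<xi>) (at v)"
        if "j < k" "v \<in> {\<xi> \<bullet> x0 - r<..<\<xi> \<bullet> x0 + r}" for j v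
      proof -
        have "(v *\<^sub>R \<xi>, \<theta>) \<in> W" using inU[of v] that by (auto simp: U_def I_def)
        then have "((\<lambda>s. x_tensor j g (v *\<^sub>R \<xi> + s *\<^sub>R \<xi>, \<theta>) \<xi>) has_real_derivative
            x_tensor (Suc j) g (v *\<^sub>R \<xi>, \<theta>) \<xi>) (at 0)"
          using that k(1) by (intro x_tensor_has_derivative[OF g W(1)]) auto
        then show ?thesis
          using derivative_along_line[where G = "\<lambda>x. x_tensor j g (x, \<theta>) \<xi>" and y = 0 and r = v and w = \<xi>] by simp
      qed
      show "\<sigma> \<le> \<bar>y - z\<bar>" if yz: "y \<in> u ` {..k}" "z \<in> u ` {..k}" "y \<noteq> z" for y z
      proof -
        obtain i where "i \<le> k" "y = u i" using yz(1) by auto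
        moreover obtain j where "j \<le> k" "z = u j" using yz(2) by auto
        moreover have "i \<noteq> j" using calculation yz(3) by auto
        ultimately show ?thesis using sep k(1) by (simp add: u_def)
      qed
    qed fact
    then obtain i where i: "i \<le> k" "\<delta> / fact (Suc k) * \<sigma> ^ k \<le> \<bar>g (u i *\<^sub>R \<xi>, \<theta>)\<bar>"
      by (auto simp: x_tensor_0)
    have "\<delta> / fact (Suc k) * \<sigma> ^ J \<le> \<delta> / fact (Suc k) * \<sigma> ^ k"
      using \<sigma> \<delta> k(1) by (intro mult_left_mono power_decreasing) auto
    also have "\<dots> \<le> \<bar>f (Y i) \<theta>\<bar>"
    proof -
      have "dist (Y i) x0 < r" using Y i(1) k(1) by simp
      from near[OF this \<theta>(2)] have "(Y i, \<theta>) \<in> V" using e2(2) \<theta>(1) by auto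
      from fg[OF this] i(2) show ?thesis by (simp add: proj u_def)
    qed
    finally show "\<exists>i\<le>J. \<delta> / fact (Suc k) * \<sigma> ^ J \<le> \<bar>f (Y i) \<theta>\<bar>" using i(1) k(1) by (intro exI[of _ i]) auto
  qed
  moreover have "r > 0" "\<delta> / fact (Suc k) > 0" using e1 e2 \<delta> by (auto simp: r_def)
  ultimately show ?thesis by blast
qed

lemma large_on_spread_mono:
  assumes "large_on_spread J \<phi> \<xi> r c x" "dist y x + r' \<le> r" "c' \<le> c"
  shows "large_on_spread J \<phi> \<xi> r' c' y"
  unfolding large_on_spread_def
proof (intro allI impI)
  fix Y \<sigma>
  assume *: "\<forall>i\<le>J. dist (Y i) y < r'" "0 < \<sigma>" "\<sigma> \<le> 1"
    "\<forall>i\<le>J. \<forall>j\<le>J. i \<noteq> j \<longrightarrow> \<sigma> \<le> \<bar>\<xi> \<bullet> Y i - \<xi> \<bullet> Y j\<bar>"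
  have "dist (Y i) x < r" if "i \<le> J" for i
    using *(1) that assms(2) dist_triangle[of "Y i" x y] by (smt (verit))
  then obtain i where "i \<le> J" "c * \<sigma> ^ J \<le> \<bar>\<phi> (Y i)\<bar>"
    using assms(1) * unfolding large_on_spread_def by blast
  moreover have "c' * \<sigma> ^ J \<le> c * \<sigma> ^ J" using assms(3) *(2) by (intro mult_right_mono) auto
  ultimately show "\<exists>i\<le>J. c' * \<sigma> ^ J \<le> \<bar>\<phi> (Y i)\<bar>" by force
qed

text \<open>The radius in the local bound also covers nearby base points and parameters, so a finite
  subcover of \<open>X0 \<times> \<Theta>\<close> by balls of half that radius gives common constants.  Only finitely many directions
  occur, which matters because each of them costs one exceptional event.\<close>

lemma uniform_lower_bound:
  fixes f :: "'d::euclidean_space \<Rightarrow> 'p::euclidean_space \<Rightarrow> real"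
  assumes "compact X0" "compact \<Theta>" "J > 0"
    and supp: "\<And>x0 \<theta>. x0 \<in> X0 \<Longrightarrow> \<theta> \<in> \<Theta> \<Longrightarrow>
      \<exists>\<xi> g. CJ_supporting J Xhat \<Theta> f x0 \<theta> \<xi> g \<and>
        Max ((\<lambda>j. \<bar>supp_coeff \<xi> g j x0 \<theta>\<bar>) ` {0..J - 1}) > 0"
  obtains \<Xi> r c where "finite \<Xi>" "\<And>\<xi>. \<xi> \<in> \<Xi> \<Longrightarrow> norm \<xi> = 1" "r > 0" "c > 0"
    "\<And>x \<theta>. x \<in> X0 \<Longrightarrow> \<theta> \<in> \<Theta> \<Longrightarrow> \<exists>\<xi>\<in>\<Xi>. large_on_spread J (\<lambda>x. f x \<theta>) \<xi> r c x"
proof -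
  define good where "good p \<xi> r c \<longleftrightarrow> norm \<xi> = 1 \<and> r > 0 \<and> c > 0 \<and>
    (\<forall>\<theta>\<in>\<Theta>. dist \<theta> (snd p) < r \<longrightarrow> large_on_spread J (\<lambda>x. f x \<theta>) \<xi> r c (fst p))" for p \<xi> r c
  have "\<forall>p\<in>X0 \<times> \<Theta>. \<exists>\<xi> r c. good p \<xi> r c"
  proof
    fix p assume p: "p \<in> X0 \<times> \<Theta>"
    obtain \<xi> g where *: "CJ_supporting J Xhat \<Theta> f (fst p) (snd p) \<xi> g"
      "Max ((\<lambda>j. \<bar>supp_coeff \<xi> g j (fst p) (snd p)\<bar>) ` {0..J - 1}) > 0"
      using supp[of "fst p" "snd p"] p by auto
    have "norm \<xi> = 1" using *(1) by (simp add: CJ_supporting_def)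
    then show "\<exists>\<xi> r c. good p \<xi> r c"
      using supporting_function_lower_bound[OF * \<open>J > 0\<close>] unfolding good_def by blast
  qed
  then obtain \<xi> r c where good: "\<And>p. p \<in> X0 \<times> \<Theta> \<Longrightarrow> good p (\<xi> p) (r p) (c p)"
    unfolding bchoice_iff by blast
  obtain C where C: "C \<subseteq> X0 \<times> \<Theta>" "finite C" "X0 \<times> \<Theta> \<subseteq> (\<Union>p\<in>C. ball p (r p / 2))"
  proof (rule compactE_image[of "X0 \<times> \<Theta>" "X0 \<times> \<Theta>" "\<lambda>p. ball p (r p / 2)"])
    show "compact (X0 \<times> \<Theta>)" using assms by (intro compact_Times)
    show "X0 \<times> \<Theta> \<subseteq> (\<Union>p\<in>X0 \<times> \<Theta>. ball p (r p / 2))"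
      using good by (fastforce simp: good_def)
  qed auto
  define r' where "r' = Min (insert 1 ((\<lambda>p. r p / 2) ` C))"
  define c' where "c' = Min (insert 1 (c ` C))"
  have pos: "r' > 0" "c' > 0"
    using C(1,2) good by (auto simp: r'_def c'_def good_def subset_iff)
  have le: "r' \<le> r p / 2" "c' \<le> c p" if "p \<in> C" for p
    unfolding r'_def c'_def using that C(2) by (rule_tac Min_le; simp)+
  show ?thesis
  proof (rule that[of "\<xi> ` C" r' c'])
    show "norm v = 1" if "v \<in> \<xi> ` C" for v using that C(1) good by (auto simp: good_def)
    fix x \<theta> assume *: "x \<in> X0" "\<theta> \<in> \<Theta>"
    then obtain p where p: "p \<in> C" "dist p (x, \<theta>) < r p / 2" using C(3) by auto
    then have d: "dist x (fst p) < r p / 2" "dist \<theta> (snd p) < r p / 2"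
      using dist_fst_le[of p "(x, \<theta>)"] dist_snd_le[of p "(x, \<theta>)"] by (auto simp: dist_commute)
    have g: "good p (\<xi> p) (r p) (c p)" using good p(1) C(1) by blast
    then have "large_on_spread J (\<lambda>x. f x \<theta>) (\<xi> p) (r p) (c p) (fst p)"
      using d *(2) by (auto simp: good_def)
    then have "large_on_spread J (\<lambda>x. f x \<theta>) (\<xi> p) r' c' x"
      using d le[OF p(1)] by (elim large_on_spread_mono) auto
    then show "\<exists>\<xi>\<in>\<xi> ` C. large_on_spread J (\<lambda>x. f x \<theta>) \<xi> r' c' x" using p(1) by blast
  qed (use pos C(2) in auto)
qed

section \<open>Asymptotics of powers\<close>

lemma eventually_powr_dominated:
  fixes C a b :: real
  assumes "C > 0" "a < b"
  shows "\<forall>\<^sub>F q in sequentially. real q powr (- b) < C * real q powr (- a)"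
proof -
  have "((\<lambda>q. real q powr (- (b - a))) \<longlongrightarrow> 0) sequentially"
    using assms(2) by (intro tendsto_neg_powr filterlim_real_sequentially) auto
  then have "\<forall>\<^sub>F q in sequentially. real q powr (- (b - a)) < C"
    using assms(1) by (rule order_tendstoD)
  then show ?thesis using eventually_gt_at_top[of 0]
  proof eventually_elim
    case (elim q)
    have "real q powr (- b) = real q powr (- (b - a)) * real q powr (- a)"
      by (simp flip: powr_add)
    then show ?case using elim by simp
  qed
qed

text \<open>For two exponents the larger power eventually exceeds twice the smaller one, so half of it is
  left after subtraction.  The sum of all \<open>\<alpha> j\<close> is a convenient upper bound for each of them.\<close>

lemma eventually_powr_separated:
  fixes \<alpha> :: "nat \<Rightarrow> real"
  assumes "inj_on \<alpha> {0..J}" "\<And>j. j \<in> {0..J} \<Longrightarrow> \<alpha> j > 0"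
  obtains E :: nat where "\<forall>\<^sub>F n in sequentially. \<forall>i\<le>J. \<forall>j\<le>J. i \<noteq> j \<longrightarrow>
    1 / real n ^ E \<le> \<bar>real n powr (- \<alpha> i) - real n powr (- \<alpha> j)\<bar>"
proof -
  obtain E :: nat where "sum \<alpha> {0..J} < real E" using reals_Archimedean2 by blast
  moreover have "\<alpha> i \<le> sum \<alpha> {0..J}" if "i \<in> {0..J}" for i
    using that assms(2) by (intro member_le_sum) (auto intro: less_imp_le)
  ultimately have E: "\<alpha> i < real E" if "i \<in> {0..J}" for i using that by fastforce
  have half: "(1 / 2 :: real) > 0" by simp
  have lt: "\<forall>\<^sub>F n in sequentially. 1 / real n ^ E \<le> \<bar>real n powr (- \<alpha> i) - real n powr (- \<alpha> j)\<bar>"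
    if "i \<in> {0..J}" "\<alpha> i < \<alpha> j" for i j
    using eventually_powr_dominated[of "1 / 2" "\<alpha> i" "\<alpha> j", OF half that(2)]
      eventually_powr_dominated[of "1 / 2" "\<alpha> i" "real E", OF half E[OF that(1)]] eventually_gt_at_top[of 0]
  proof eventually_elim
    case (elim n)
    then have "1 / real n ^ E = real n powr (- real E)"
      by (simp add: powr_minus_divide powr_realpow)
    then show ?case using elim by simp
  qed
  have "\<forall>\<^sub>F n in sequentially. i \<noteq> j \<longrightarrow>
      1 / real n ^ E \<le> \<bar>real n powr (- \<alpha> i) - real n powr (- \<alpha> j)\<bar>" if "i \<in> {..J}" "j \<in> {..J}" for i j
  proof (cases "\<alpha> i" "\<alpha> j" rule: linorder_cases)
    case less
    then show ?thesis using lt[of i j] that by (auto elim: eventually_mono)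
  next
    case equal
    then show ?thesis using assms(1) that by (auto simp: inj_on_def)
  next
    case greater
    then show ?thesis using lt[of j i] that by (auto simp: abs_minus_commute elim: eventually_mono)
  qed
  then have "\<forall>\<^sub>F n in sequentially. \<forall>i\<in>{..J}. \<forall>j\<in>{..J}. i \<noteq> j \<longrightarrow>
    1 / real n ^ E \<le> \<bar>real n powr (- \<alpha> i) - real n powr (- \<alpha> j)\<bar>"
    by (intro eventually_ball_finite ballI) auto
  then show ?thesis by (intro that[of E]) (simp add: Ball_def)
qed

lemma eventually_at_power:
  assumes "\<forall>\<^sub>F n in sequentially. P n" "D \<ge> 1"
  shows "\<forall>\<^sub>F q in sequentially. P (q ^ D :: nat)"
proof -
  obtain n0 where n0: "\<And>n. n \<ge> n0 \<Longrightarrow> P n" using assms(1) by (auto simp: eventually_sequentially)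
  have "P (q ^ D)" if "q \<ge> max 1 n0" for q
  proof (rule n0)
    have "q \<le> q ^ D" using that assms(2) by (intro self_le_power) auto
    then show "q ^ D \<ge> n0" using that by linarith
  qed
  then show ?thesis unfolding eventually_sequentially by blast
qed

section \<open>Lower bounds for \<open>chi0\<close> along a path\<close>

text \<open>The time interval may depend on \<open>\<theta>\<close>; only its length and the level \<open>y\<close> have to be
  uniform.\<close>

lemma chi0_ge:
  assumes y: "0 \<le> y" and h: "0 \<le> h"
    and long: "\<And>\<theta>. \<theta> \<in> \<Theta> \<Longrightarrow> \<theta> \<noteq> \<theta>s \<Longrightarrow> \<exists>u. {u..u + h} \<subseteq> {0..T} \<and>
      (\<forall>t\<in>{u..u + h}. y \<le> Q (X t \<omega>) \<theta> / (norm (\<theta> - \<theta>s))\<^sup>2)"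
  shows "ennreal (y * h) \<le> chi0 T X Q \<Theta> \<theta>s \<omega>"
  unfolding chi0_def
proof (rule INF_greatest)
  fix \<theta> assume "\<theta> \<in> {\<theta> \<in> \<Theta>. \<theta> \<noteq> \<theta>s}"
  then have \<theta>: "\<theta> \<in> \<Theta>" "\<theta> \<noteq> \<theta>s" by auto
  define d where "d = (norm (\<theta> - \<theta>s))\<^sup>2"
  have d: "d > 0" using \<theta> by (simp add: d_def)
  obtain u where u: "{u..u + h} \<subseteq> {0..T}" and "\<forall>t\<in>{u..u + h}. y \<le> Q (X t \<omega>) \<theta> / d"
    using long[OF \<theta>] unfolding d_def by blast
  then have le: "y * d \<le> Q (X t \<omega>) \<theta>" if "t \<in> {u..u + h}" for t
    using that d by (simp add: pos_le_divide_eq)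
  have I: "{u..u + h} \<in> sets (lebesgue_on {0..T})"
    using u by (intro sets_restrict_space_iff[THEN iffD2]) auto
  have "ennreal (y * d) * emeasure (lebesgue_on {0..T}) {u..u + h} =
      (\<integral>\<^sup>+ t. ennreal (y * d) * indicator {u..u + h} t \<partial>lebesgue_on {0..T})"
    using I by (simp add: nn_integral_cmult_indicator)
  also have "\<dots> \<le> (\<integral>\<^sup>+ t. ennreal (Q (X t \<omega>) \<theta>) \<partial>lebesgue_on {0..T})"
    using le by (intro nn_integral_mono) (auto split: split_indicator intro: ennreal_leI)
  also have "emeasure (lebesgue_on {0..T}) {u..u + h} = ennreal h"
    using u h by (subst emeasure_restrict_space) auto
  finally have "ennreal (y * d * h) \<le> (\<integral>\<^sup>+ t. ennreal (Q (X t \<omega>) \<theta>) \<partial>lebesgue_on {0..T})"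
    using y h d by (simp add: ennreal_mult)
  then have "ennreal (y * d * h) / ennreal d \<le> (\<integral>\<^sup>+ t. ennreal (Q (X t \<omega>) \<theta>) \<partial>lebesgue_on {0..T}) / ennreal d"
    by (rule divide_right_mono_ennreal)
  moreover have "ennreal (y * d * h) / ennreal d = ennreal (y * h)"
    using y h d by (simp add: divide_ennreal)
  ultimately show "ennreal (y * h) \<le>
      (\<integral>\<^sup>+ t. ennreal (Q (X t \<omega>) \<theta>) \<partial>lebesgue_on {0..T}) / ennreal ((norm (\<theta> - \<theta>s))\<^sup>2)"
    by (simp add: d_def)
qed

lemma path_osc_lessD:
  assumes "path_osc T Xhat X n \<omega> < ereal \<delta>" "X s \<omega> \<in> Xhat" "0 \<le> s" "s \<le> t" "t \<le> T" "t \<le> s + 1 / real n"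
  shows "dist (X t \<omega>) (X s \<omega>) < \<delta>"
proof -
  have "ereal (norm (X t \<omega> - X s \<omega>)) \<le> path_osc T Xhat X n \<omega>"
    unfolding path_osc_def by (rule SUP_upper2[of "(s, t)"]) (use assms in auto)
  then have "ereal (norm (X t \<omega> - X s \<omega>)) < ereal \<delta>" using assms(1) by (rule le_less_trans)
  then show ?thesis by (simp add: dist_norm)
qed

text \<open>The \<open>\<xi>\<close>-components of the visited points differ by at least the difference of their absolute
  values, so the separation hypothesis holds for any signs.  Two oscillation steps, from \<open>\<tau>\<close> to
  \<open>s\<close> and from \<open>s\<close> to \<open>s + t\<close>, keep all points within \<open>2 * \<delta>\<close> of \<open>X \<tau>\<close>; hence
  the factor \<open>2\<close> in the conclusion.\<close>

lemma increment_event_visits_large_value: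
  fixes X :: "real \<Rightarrow> 'a \<Rightarrow> 'd::euclidean_space" and q :: nat
  assumes incr: "\<omega> \<in> increment_event M T X \<tau> J c0 \<alpha> \<xi> \<epsilon> n" and window: "real n powr (- c0) \<le> 1 / real q"
    and osc: "path_osc T Xhat X q \<omega> < ereal \<delta>"
    and \<tau>: "0 \<le> \<tau> \<omega>" and x: "x = X (\<tau> \<omega>) \<omega>" and r: "0 < r" "2 * \<delta> \<le> r" "ball x r \<subseteq> Xhat"
    and \<sigma>: "0 < \<sigma>" "\<sigma> \<le> 1"
      "\<And>i j. i \<le> J \<Longrightarrow> j \<le> J \<Longrightarrow> i \<noteq> j \<Longrightarrow> \<sigma> \<le> \<bar>real n powr (- \<alpha> i) - real n powr (- \<alpha> j)\<bar>"
    and large: "large_on_spread J \<phi> \<xi> r c x"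
  shows "\<exists>u. \<tau> \<omega> \<le> u \<and> u \<le> \<tau> \<omega> + 2 / real q \<and> u \<le> T \<and> dist (X u \<omega>) x < 2 * \<delta> \<and>
    c * \<sigma> ^ J \<le> \<bar>\<phi> (X u \<omega>)\<bar>"
proof -
  from incr obtain s where s: "\<tau> \<omega> \<le> s" "s \<le> \<tau> \<omega> + real n powr (- c0)"
    and ex: "\<forall>j\<in>{0..J}. \<exists>t\<in>{0 .. real n powr (- c0)}. s + t \<le> T \<and>
      X (s + t) \<omega> - X s \<omega> \<in> cone_sector_sym \<xi> \<epsilon> \<and> \<bar>\<xi> \<bullet> (X (s + t) \<omega> - X s \<omega>)\<bar> = real n powr (- \<alpha> j)"
    unfolding increment_event_def by auto
  then obtain t where "\<forall>j\<in>{0..J}. t j \<in> {0 .. real n powr (- c0)} \<and> s + t j \<le> T \<and>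
      X (s + t j) \<omega> - X s \<omega> \<in> cone_sector_sym \<xi> \<epsilon> \<and>
      \<bar>\<xi> \<bullet> (X (s + t j) \<omega> - X s \<omega>)\<bar> = real n powr (- \<alpha> j)"
    unfolding Bex_def bchoice_iff by blast
  then have t: "0 \<le> t j \<and> t j \<le> real n powr (- c0) \<and> s + t j \<le> T \<and>
      \<bar>\<xi> \<bullet> (X (s + t j) \<omega> - X s \<omega>)\<bar> = real n powr (- \<alpha> j)" if "j \<le> J" for j
    using that by auto
  have "s \<le> T" using t[of 0] by simp
  have "dist (X s \<omega>) x < \<delta>"
    unfolding x using s window \<tau> \<open>s \<le> T\<close> r x by (intro path_osc_lessD[OF osc]) auto
  moreover have "\<delta> \<le> r" using r(1,2) by simp
  ultimately have sX: "X s \<omega> \<in> Xhat" using r(3) by (auto simp: dist_commute subset_iff)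
  have close: "dist (X (s + t j) \<omega>) x < 2 * \<delta>" if "j \<le> J" for j
  proof -
    have "dist (X (s + t j) \<omega>) (X s \<omega>) < \<delta>"
      using t[OF that] s window \<tau> by (intro path_osc_lessD[OF osc sX]) auto
    then show ?thesis using \<open>dist (X s \<omega>) x < \<delta>\<close> dist_triangle[of "X (s + t j) \<omega>" x "X s \<omega>"] by simp
  qed
  have "\<exists>i\<le>J. c * \<sigma> ^ J \<le> \<bar>\<phi> (X (s + t i) \<omega>)\<bar>"
  proof (rule large[unfolded large_on_spread_def, rule_format])
    show "dist (X (s + t i) \<omega>) x < r" if "i \<le> J" for i using close[OF that] r(2) by simp
    show "\<sigma> \<le> \<bar>\<xi> \<bullet> X (s + t i) \<omega> - \<xi> \<bullet> X (s + t j) \<omega>\<bar>" if "i \<le> J" "j \<le> J" "i \<noteq> j" for i j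
    proof -
      define v where "v j = \<xi> \<bullet> (X (s + t j) \<omega> - X s \<omega>)" for j
      have "\<sigma> \<le> \<bar>\<bar>v i\<bar> - \<bar>v j\<bar>\<bar>" using \<sigma>(3)[OF that] t that by (simp add: v_def)
      also have "\<dots> \<le> \<bar>v i - v j\<bar>" by (rule abs_triangle_ineq3)
      finally show ?thesis by (simp add: v_def inner_diff_right)
    qed
  qed (use \<sigma> in auto)
  then obtain i where i: "i \<le> J" "c * \<sigma> ^ J \<le> \<bar>\<phi> (X (s + t i) \<omega>)\<bar>" by blast
  show ?thesis
    using i close[OF i(1)] t[OF i(1)] s window by (intro exI[of _ "s + t i"]) auto
qed

text \<open>After the visit to a large value at time \<open>u\<close>, the path moves less than \<open>\<delta>'\<close> during
  \<open>1 / N\<close>, so \<open>f\<close> loses at most \<open>K * \<delta>'\<close>, half of the level \<open>c * \<sigma> ^ J\<close>.  The total time budget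
  is \<open>2 / q\<close> for the visit and \<open>1 / N \<le> 1 / q\<close> for staying there.\<close>

lemma chi0_ge_on_good_path:
  fixes X :: "real \<Rightarrow> 'a \<Rightarrow> 'd::euclidean_space" and q N :: nat and \<Theta> :: "'p::euclidean_space set"
  assumes incr: "\<And>\<xi>. \<xi> \<in> \<Xi> \<Longrightarrow> \<omega> \<in> increment_event M T X \<tau> J c0 \<alpha> \<xi> \<epsilon> n"
    and window: "real n powr (- c0) \<le> 1 / real q"
    and osc: "path_osc T Xhat X q \<omega> < ereal \<delta>" "path_osc T Xhat X N \<omega> < ereal \<delta>'"
    and \<delta>': "\<delta>' \<le> \<delta>" "K * \<delta>' \<le> c / 2 * \<sigma> ^ J"
    and \<tau>: "0 \<le> \<tau> \<omega>" "\<tau> \<omega> + 3 / real q \<le> T" and N: "q > 0" "N \<ge> q"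
    and x: "x = X (\<tau> \<omega>) \<omega>" and r: "0 < r" "3 * \<delta> \<le> r" "ball x r \<subseteq> Xhat"
    and \<sigma>: "0 < \<sigma>" "\<sigma> \<le> 1"
      "\<And>i j. i \<le> J \<Longrightarrow> j \<le> J \<Longrightarrow> i \<noteq> j \<Longrightarrow> \<sigma> \<le> \<bar>real n powr (- \<alpha> i) - real n powr (- \<alpha> j)\<bar>"
    and c: "c > 0"
    and large: "\<And>\<theta>. \<theta> \<in> \<Theta> \<Longrightarrow> \<exists>\<xi>\<in>\<Xi>. large_on_spread J (\<lambda>x. f x \<theta>) \<xi> r c x"
    and Qf: "\<rho>R > 0" "\<And>x \<theta>. x \<in> Xhat \<Longrightarrow> \<theta> \<in> \<Theta> \<Longrightarrow> \<theta> \<noteq> \<theta>s \<Longrightarrow>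
      Q x \<theta> / (norm (\<theta> - \<theta>s))\<^sup>2 \<ge> \<bar>f x \<theta>\<bar> powr \<rho>R"
    and lip: "\<And>\<theta>. \<theta> \<in> \<Theta> \<Longrightarrow> K-lipschitz_on Xhat (\<lambda>x. f x \<theta>)"
  shows "ennreal ((c / 2 * \<sigma> ^ J) powr \<rho>R * (1 / real N)) \<le> chi0 T X Q \<Theta> \<theta>s \<omega>"
proof (rule chi0_ge)
  fix \<theta> assume \<theta>: "\<theta> \<in> \<Theta>" "\<theta> \<noteq> \<theta>s"
  have "\<delta> > 0"
    using path_osc_lessD[OF osc(1), of "\<tau> \<omega>" "\<tau> \<omega>"] \<tau> r x zero_le_dist[of x x] by (auto simp: subset_iff)
  obtain \<xi> where \<xi>: "\<xi> \<in> \<Xi>" "large_on_spread J (\<lambda>x. f x \<theta>) \<xi> r c x" using large[OF \<theta>(1)] by blast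
  obtain u where u: "\<tau> \<omega> \<le> u" "u \<le> \<tau> \<omega> + 2 / real q" "u \<le> T" "dist (X u \<omega>) x < 2 * \<delta>"
    "c * \<sigma> ^ J \<le> \<bar>f (X u \<omega>) \<theta>\<bar>"
    using increment_event_visits_large_value[OF incr[OF \<xi>(1)] window osc(1) \<tau>(1) x r(1) _ r(3) \<sigma> \<xi>(2)]
      r(2) \<open>\<delta> > 0\<close> by auto
  have uX: "X u \<omega> \<in> Xhat" using u(4) r(2,3) \<open>\<delta> > 0\<close> by (auto simp: dist_commute subset_iff)
  have Nq: "1 / real N \<le> 1 / real q" using N by (intro divide_left_mono) auto
  have "u + 1 / real N \<le> T" using u(2) \<tau>(2) Nq by simp
  then have "{u..u + 1 / real N} \<subseteq> {0..T}" using \<tau>(1) u(1) by auto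
  moreover have "(c / 2 * \<sigma> ^ J) powr \<rho>R \<le> Q (X t \<omega>) \<theta> / (norm (\<theta> - \<theta>s))\<^sup>2" if t: "t \<in> {u..u + 1 / real N}" for t
  proof -
    have d: "dist (X t \<omega>) (X u \<omega>) < \<delta>'"
      using t \<open>u + 1 / real N \<le> T\<close> \<tau> u by (intro path_osc_lessD[OF osc(2) uX]) auto
    then have "dist (X t \<omega>) x < r"
      using u(4) \<delta>'(1) r(2) dist_triangle[of "X t \<omega>" x "X u \<omega>"] by simp
    then have tX: "X t \<omega> \<in> Xhat" using r(3) by (auto simp: dist_commute subset_iff)
    have "\<bar>f (X t \<omega>) \<theta> - f (X u \<omega>) \<theta>\<bar> \<le> K * dist (X t \<omega>) (X u \<omega>)"
      using lipschitz_onD[OF lip[OF \<theta>(1)] tX uX] by (simp add: dist_real_def)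
    also have "\<dots> \<le> K * \<delta>'" using d lipschitz_on_nonneg[OF lip[OF \<theta>(1)]] by (intro mult_left_mono) auto
    finally have "c / 2 * \<sigma> ^ J \<le> \<bar>f (X t \<omega>) \<theta>\<bar>" using u(5) \<delta>'(2) by simp
    then have "(c / 2 * \<sigma> ^ J) powr \<rho>R \<le> \<bar>f (X t \<omega>) \<theta>\<bar> powr \<rho>R"
      using c \<sigma> Qf(1) by (intro powr_mono2) auto
    also have "\<dots> \<le> Q (X t \<omega>) \<theta> / (norm (\<theta> - \<theta>s))\<^sup>2" using Qf(2)[OF tX \<theta>] .
    finally show ?thesis .
  qed
  ultimately show "\<exists>u. {u..u + 1 / real N} \<subseteq> {0..T} \<and>
      (\<forall>t\<in>{u..u + 1 / real N}. (c / 2 * \<sigma> ^ J) powr \<rho>R \<le> Q (X t \<omega>) \<theta> / (norm (\<theta> - \<theta>s))\<^sup>2)"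
    by blast
qed auto

section \<open>Rapidly decreasing sequences and polynomial tails\<close>

lemma rapid_seqsI:
  assumes "\<And>n. n \<ge> 1 \<Longrightarrow> 0 \<le> a n" "\<And>L. L > 0 \<Longrightarrow> \<exists>C. \<forall>n\<ge>1. a n \<le> C / real n powr L"
  shows "a \<in> rapid_seqs"
  using assms by (auto simp: rapid_seqs_def)

lemma rapid_seqs_add:
  assumes "a \<in> rapid_seqs" "b \<in> rapid_seqs"
  shows "(\<lambda>n. a n + b n) \<in> rapid_seqs"
proof (rule rapid_seqsI)
  fix L :: real assume "L > 0"
  then obtain C C' where "\<forall>n\<ge>1. a n \<le> C / real n powr L" "\<forall>n\<ge>1. b n \<le> C' / real n powr L"
    using assms unfolding rapid_seqs_def by blast
  then show "\<exists>C. \<forall>n\<ge>1. a n + b n \<le> C / real n powr L"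
    by (intro exI[of _ "C + C'"]) (auto simp: add_divide_distrib intro: add_mono)
qed (use assms in \<open>auto simp: rapid_seqs_def\<close>)

lemma rapid_seqs_sum:
  assumes "finite I" "\<And>i. i \<in> I \<Longrightarrow> a i \<in> rapid_seqs"
  shows "(\<lambda>n. \<Sum>i\<in>I. a i n) \<in> rapid_seqs"
  using assms
proof (induction I rule: finite_induct)
  case empty
  show ?case by (intro rapid_seqsI) (auto intro!: exI[of _ 0])
next
  case (insert i I)
  then show ?case by (simp add: rapid_seqs_add)
qed

lemma rapid_seqs_power:
  assumes "a \<in> rapid_seqs" "D \<ge> 1"
  shows "(\<lambda>q. a (q ^ D)) \<in> rapid_seqs"
proof (rule rapid_seqsI)
  fix L :: real assume L: "L > 0"
  then obtain C where C: "\<forall>n\<ge>1. a n \<le> C / real n powr L" using assms unfolding rapid_seqs_def by blast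
  have "a (q ^ D) \<le> \<bar>C\<bar> / real q powr L" if "q \<ge> 1" for q
  proof -
    have q: "q ^ D \<ge> q" "q ^ D \<ge> 1" using that assms(2) by (auto simp: self_le_power)
    have "a (q ^ D) \<le> \<bar>C\<bar> / real (q ^ D) powr L"
      using C q(2) by (smt (verit) divide_right_mono powr_ge_zero)
    also have "\<dots> \<le> \<bar>C\<bar> / real q powr L"
      using q that L by (intro divide_left_mono powr_mono2 mult_pos_pos) (auto simp del: of_nat_power)
    finally show ?thesis .
  qed
  then show "\<exists>C. \<forall>q\<ge>1. a (q ^ D) \<le> C / real q powr L" by blast
qed (use assms in \<open>auto simp: rapid_seqs_def\<close>)

text \<open>For large \<open>\<rho>\<close> take the largest \<open>q\<close> with \<open>q ^ A \<le> \<rho>\<close>.  It is at least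
  \<open>\<rho> powr (1 / A) / 2\<close>, so decay of order \<open>L * A\<close> in \<open>q\<close> gives decay of order \<open>L\<close> in
  \<open>\<rho>\<close>.  Below the threshold \<open>R\<close> a large constant suffices.\<close>

lemma (in prob_space) rapid_tail_from_powers:
  fixes Z :: "'a \<Rightarrow> ennreal"
  assumes Z: "Z \<in> borel_measurable M" and A: "A \<ge> 1" and b: "b \<in> rapid_seqs"
    and ev: "\<forall>\<^sub>F q in sequentially. \<P>(\<omega> in M. Z \<omega> \<le> ennreal (1 / real q ^ A)) \<le> b q"
  shows "\<forall>L>0. \<exists>c>0. \<forall>\<rho>>0. \<P>(\<omega> in M. Z \<omega> \<le> ennreal (1 / \<rho>)) \<le> c * \<rho> powr (- L)"
proof (intro allI impI)
  fix L :: real assume L: "L > 0"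
  obtain q0 where q0: "\<And>q. q \<ge> q0 \<Longrightarrow> \<P>(\<omega> in M. Z \<omega> \<le> ennreal (1 / real q ^ A)) \<le> b q"
    using ev unfolding eventually_sequentially by blast
  define L' where "L' = L * real A"
  have L': "L' > 0" using L A by (simp add: L'_def)
  then obtain C where C: "\<And>n. n \<ge> 1 \<Longrightarrow> b n \<le> C / real n powr L'" using b unfolding rapid_seqs_def by blast
  define R where "R = real (max 1 q0) ^ A"
  define c where "c = max (\<bar>C\<bar> * 2 powr L' + 1) (R powr L)"
  have R: "R \<ge> 1" by (simp add: R_def)
  have "\<P>(\<omega> in M. Z \<omega> \<le> ennreal (1 / \<rho>)) \<le> c * \<rho> powr (- L)" if \<rho>: "\<rho> > 0" for \<rho>
  proof (cases "\<rho> < R")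
    case True
    have "1 = \<rho> powr L * \<rho> powr (- L)" using \<rho> by (simp flip: powr_add)
    also have "\<dots> \<le> R powr L * \<rho> powr (- L)"
      using True \<rho> L by (intro mult_right_mono powr_mono2) auto
    also have "\<dots> \<le> c * \<rho> powr (- L)" by (intro mult_right_mono) (auto simp: c_def)
    finally show ?thesis using prob_le_1 order_trans by blast
  next
    case False
    define y where "y = \<rho> powr (1 / real A)"
    have yA: "y ^ A = \<rho>" using \<rho> A by (simp add: y_def powr_powr flip: powr_realpow)
    have y0: "y \<ge> 0" by (simp add: y_def)
    have ymax: "y \<ge> real (max 1 q0)"
    proof (rule ccontr)
      assume "\<not> y \<ge> real (max 1 q0)"
      then have "y ^ A < real (max 1 q0) ^ A" using A y0 by (intro power_strict_mono) linarith+
      then have "\<rho> < R" by (simp only: yA R_def)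
      with False show False by blast
    qed
    then have ymax': "y \<ge> 1" "y \<ge> real q0" by linarith+
    define q where "q = nat \<lfloor>y\<rfloor>"
    have q: "real q \<le> y" "y < real q + 1" using y0 unfolding q_def by linarith+
    have qge: "q \<ge> q0" "q \<ge> 1" using ymax' by (auto simp: q_def intro!: le_nat_floor)
    have "real q ^ A \<le> \<rho>" using q(1) yA by (metis of_nat_0_le_iff power_mono)
    then have "1 / \<rho> \<le> 1 / real q ^ A" using qge(2) \<rho> by (intro divide_left_mono) auto
    then have "\<P>(\<omega> in M. Z \<omega> \<le> ennreal (1 / \<rho>)) \<le> \<P>(\<omega> in M. Z \<omega> \<le> ennreal (1 / real q ^ A))"
      using Z by (intro finite_measure_mono) (auto intro: order_trans ennreal_leI)
    also have "\<dots> \<le> b q" using q0 qge(1) .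
    also have "\<dots> \<le> \<bar>C\<bar> / real q powr L'"
      using C[OF qge(2)] by (smt (verit) divide_right_mono powr_ge_zero)
    also have "\<dots> \<le> \<bar>C\<bar> / (y / 2) powr L'"
    proof (intro divide_left_mono powr_mono2 mult_pos_pos)
      have "y \<le> real q + real q" using q(2) qge(2) by linarith
      then show "y / 2 \<le> real q" by simp
    qed (use L' qge ymax' in auto)
    also have "\<dots> = \<bar>C\<bar> * 2 powr L' * y powr (- L')"
      using y0 by (simp add: powr_divide powr_minus field_simps)
    also have "y powr (- L') = \<rho> powr (- L)"
      using A by (simp add: y_def powr_powr L'_def)
    also have "\<bar>C\<bar> * 2 powr L' * \<rho> powr (- L) \<le> c * \<rho> powr (- L)"
      by (intro mult_right_mono) (auto simp: c_def)
    finally show ?thesis .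
  qed
  moreover have "c > 0" by (auto simp: c_def less_max_iff_disj intro!: add_nonneg_pos)
  ultimately show "\<exists>c>0. \<forall>\<rho>>0. \<P>(\<omega> in M. Z \<omega> \<le> ennreal (1 / \<rho>)) \<le> c * \<rho> powr (- L)" by blast
qed

text \<open>The complement of the support is a union of open null sets, of which countably many suffice by
  the Lindelof property.\<close>

lemma AE_in_measure_support:
  fixes \<mu> :: "'b::second_countable_topology measure"
  assumes "sets \<mu> = sets borel"
  shows "AE x in \<mu>. x \<in> measure_support \<mu>"
proof -
  define \<U> where "\<U> = {U. open U \<and> emeasure \<mu> U = 0}"
  obtain \<V> where \<V>: "\<V> \<subseteq> \<U>" "countable \<V>" "\<Union>\<V> = \<Union>\<U>"
    using Lindelof[of \<U>] by (auto simp: \<U>_def)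
  have "U \<in> null_sets \<mu>" if "U \<in> \<V>" for U using \<V>(1) that assms by (auto simp: \<U>_def intro!: null_setsI)
  then have "\<Union>\<V> \<in> null_sets \<mu>" using null_sets_UN'[OF \<V>(2), of "\<lambda>U. U"] by simp
  then have "AE x in \<mu>. x \<notin> \<Union>\<U>" using AE_not_in \<V>(3) by metis
  then show ?thesis
    by (rule AE_mp) (auto simp: measure_support_def \<U>_def zero_less_iff_neq_zero)
qed

section \<open>The tail of \<open>chi0\<close>\<close>

theorem proposition2:
  fixes M :: "'a measure" and F :: "real \<Rightarrow> 'a measure" and T :: real
    and X :: "real \<Rightarrow> 'a \<Rightarrow> real ^ 'd"
    and \<Theta> :: "(real ^ 'p) set" and \<theta>s :: "real ^ 'p"
    and X0 Xhat :: "(real ^ 'd) set"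
    and Q f :: "real ^ 'd \<Rightarrow> real ^ 'p \<Rightarrow> real"
    and J :: nat
    and \<tau> :: "'a \<Rightarrow> real" and c0 :: real and \<alpha> :: "nat \<Rightarrow> real"
    and \<rho>R \<beta>0 :: real
  (* setting; a filtration indexed by [0,T] is extended constantly to the real line *)
  assumes T: "T > 0"
    and M: "prob_space M"
    and F: "filtration (space M) F" "\<And>t. subalgebra M (F t)"
    and X: "adapted_process F T X" "separable_process M T X"
    and \<theta>s: "\<theta>s \<in> \<Theta>"
    and X0: "X0 \<subseteq> interior Xhat"
    and Q_nonneg: "\<And>x \<theta>. \<theta> \<in> \<Theta> \<Longrightarrow> Q x \<theta> \<ge> 0"
    and J: "J > 0"
    and meas_Q: "\<And>\<omega> \<theta>. \<omega> \<in> space M \<Longrightarrow> \<theta> \<in> \<Theta> \<Longrightarrow>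
      (\<lambda>t. Q (X t \<omega>) \<theta>) \<in> borel_measurable (lebesgue_on {0..T})"
    and meas_chi0: "chi0 T X Q \<Theta> \<theta>s \<in> borel_measurable M"
  (* (N1) *)
    and N1_i: "compact X0" "compact \<Theta>"
    and N1_ii: "\<And>x0 \<theta>. x0 \<in> X0 \<Longrightarrow> \<theta> \<in> \<Theta> \<Longrightarrow>
      \<exists>\<xi> g. CJ_supporting J Xhat \<Theta> f x0 \<theta> \<xi> g \<and>
        Max ((\<lambda>j. \<bar>supp_coeff \<xi> g j x0 \<theta>\<bar>) ` {0..J - 1}) > 0"
    and N1_iii_\<tau>: "stopping_time F \<tau>" "\<And>\<omega>. \<omega> \<in> space M \<Longrightarrow> \<tau> \<omega> \<in> {0..T}"
      "esssup M (\<lambda>\<omega>. ereal (\<tau> \<omega>)) < ereal T"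
    and N1_iii_X\<tau>: "(\<lambda>\<omega>. X (\<tau> \<omega>) \<omega>) \<in> borel_measurable M"
      "measure_support (distr M borel (\<lambda>\<omega>. X (\<tau> \<omega>) \<omega>)) \<subseteq> interior X0"
    and N1_iii_const: "c0 > 0" "\<And>j. j \<in> {0..J} \<Longrightarrow> \<alpha> j > 0" "inj_on \<alpha> {0..J}"
      "Min (\<alpha> ` {0..J}) > c0 / 2"
    and N1_iii_meas: "\<And>\<xi> \<epsilon> n. norm \<xi> = 1 \<Longrightarrow> \<epsilon> \<in> {0<..<1} \<Longrightarrow> n \<ge> 1 \<Longrightarrow>
      increment_event M T X \<tau> J c0 \<alpha> \<xi> \<epsilon> n \<in> sets M"
    and N1_iii: "\<And>\<xi> \<epsilon>. norm \<xi> = 1 \<Longrightarrow> \<epsilon> \<in> {0<..<1} \<Longrightarrow>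
      (\<lambda>n. 1 - measure M (increment_event M T X \<tau> J c0 \<alpha> \<xi> \<epsilon> n)) \<in> rapid_seqs"
  (* (R) *)
    and R_bound: "\<rho>R > 0" "\<And>x \<theta>. x \<in> Xhat \<Longrightarrow> \<theta> \<in> \<Theta> \<Longrightarrow> \<theta> \<noteq> \<theta>s \<Longrightarrow>
      Q x \<theta> / (norm (\<theta> - \<theta>s))\<^sup>2 \<ge> \<bar>f x \<theta>\<bar> powr \<rho>R"
    and R_lipschitz: "\<exists>K. \<forall>\<theta>\<in>\<Theta>. K-lipschitz_on Xhat (\<lambda>x. f x \<theta>)"
  (* (C) *)
    and C_const: "\<beta>0 > 0"
    and C_meas: "\<And>n. n \<ge> 1 \<Longrightarrow>
      {\<omega>\<in>space M. path_osc T Xhat X n \<omega> \<ge> ereal (real n powr (- \<beta>0))} \<in> sets M"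
    and C: "(\<lambda>n. \<P>(\<omega> in M. path_osc T Xhat X n \<omega> \<ge> ereal (real n powr (- \<beta>0)))) \<in> rapid_seqs"
  shows "\<forall>L>0. \<exists>c>0. \<forall>\<rho>>0.
    \<P>(\<omega> in M. chi0 T X Q \<Theta> \<theta>s \<omega> \<le> ennreal (1 / \<rho>)) \<le> c * \<rho> powr (- L)"
proof -
  interpret prob_space M by (rule M)
  obtain K where lip: "\<And>\<theta>. \<theta> \<in> \<Theta> \<Longrightarrow> K-lipschitz_on Xhat (\<lambda>x. f x \<theta>)" using R_lipschitz by blast
  have "K \<ge> 0" using lipschitz_on_nonneg[OF lip[OF \<theta>s]] .
  obtain \<Xi> r1 c where \<Xi>: "finite \<Xi>" "\<And>\<xi>. \<xi> \<in> \<Xi> \<Longrightarrow> norm \<xi> = 1" and r1: "r1 > 0" and c: "c > 0"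
    and large1: "\<And>x \<theta>. x \<in> X0 \<Longrightarrow> \<theta> \<in> \<Theta> \<Longrightarrow> \<exists>\<xi>\<in>\<Xi>. large_on_spread J (\<lambda>x. f x \<theta>) \<xi> r1 c x"
    using uniform_lower_bound[OF N1_i J N1_ii] by metis
  obtain r2 where r2: "r2 > 0" "(\<Union>x\<in>X0. ball x r2) \<subseteq> interior Xhat"
    using compact_subset_open_imp_ball_epsilon_subset[OF N1_i(1) open_interior X0] by metis
  define r where "r = min r1 r2"
  have r: "r > 0" using r1 r2 by (simp add: r_def)
  have ball: "ball x r \<subseteq> Xhat" if "x \<in> X0" for x
  proof -
    have "ball x r \<subseteq> ball x r2" by (simp add: r_def subset_ball)
    also have "\<dots> \<subseteq> interior Xhat" using r2(2) that by blast
    also have "\<dots> \<subseteq> Xhat" by (rule interior_subset)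
    finally show ?thesis .
  qed
  have large: "\<exists>\<xi>\<in>\<Xi>. large_on_spread J (\<lambda>x. f x \<theta>) \<xi> r c x" if x\<theta>: "x \<in> X0" "\<theta> \<in> \<Theta>" for x \<theta>
  proof -
    obtain \<xi> where \<xi>: "\<xi> \<in> \<Xi>" "large_on_spread J (\<lambda>x. f x \<theta>) \<xi> r1 c x" using large1[OF x\<theta>] by blast
    from \<xi>(2) have "large_on_spread J (\<lambda>x. f x \<theta>) \<xi> r c x"
      by (rule large_on_spread_mono) (simp_all add: r_def)
    with \<xi>(1) show ?thesis by blast
  qed

  \<comment> \<open>The gap between \<open>T'\<close> and \<open>T\<close> leaves room after \<open>\<tau>\<close> for the path to be observed.\<close>
  obtain T' where T': "esssup M (\<lambda>\<omega>. ereal (\<tau> \<omega>)) < ereal T'" "T' < T"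
    using ereal_dense2[OF N1_iii_\<tau>(3)] by auto
  have AE_\<tau>: "AE \<omega> in M. \<tau> \<omega> \<le> T'"
    using esssup_AE[of "\<lambda>\<omega>. ereal (\<tau> \<omega>)" M]
  proof (rule AE_mp, intro AE_I2 impI)
    fix \<omega> assume "ereal (\<tau> \<omega>) \<le> esssup M (\<lambda>\<omega>. ereal (\<tau> \<omega>))"
    then have "ereal (\<tau> \<omega>) < ereal T'" using T'(1) by (rule le_less_trans)
    then show "\<tau> \<omega> \<le> T'" by simp
  qed
  have "AE \<omega> in M. X (\<tau> \<omega>) \<omega> \<in> measure_support (distr M borel (\<lambda>\<omega>. X (\<tau> \<omega>) \<omega>))"
    by (rule AE_distrD[OF N1_iii_X\<tau>(1) AE_in_measure_support]) simp
  then have AE_X0: "AE \<omega> in M. X (\<tau> \<omega>) \<omega> \<in> X0"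
    by (rule AE_mp) (use N1_iii_X\<tau>(2) interior_subset in \<open>auto intro!: AE_I2\<close>)

  \<comment> \<open>With this \<open>D\<close>, the window \<open>(q ^ D) powr (- c0)\<close> of the increment event fits into \<open>1 / q\<close>.\<close>
  obtain D :: nat where D: "1 / c0 < real D" using reals_Archimedean2 by blast
  have "D \<ge> 1" using D N1_iii_const(1) by (cases D) (auto simp: divide_less_0_iff)
  have Dc: "1 \<le> real D * c0" using D N1_iii_const(1) by (simp add: pos_divide_less_eq less_imp_le)
  obtain E :: nat where E: "\<forall>\<^sub>F n in sequentially. \<forall>i\<le>J. \<forall>j\<le>J. i \<noteq> j \<longrightarrow>
      1 / real n ^ E \<le> \<bar>real n powr (- \<alpha> i) - real n powr (- \<alpha> j)\<bar>"
    using eventually_powr_separated[OF N1_iii_const(3,2)] by blast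
  \<comment> \<open>\<open>\<sigma> ^ J = q powr (- H)\<close> for the separation \<open>\<sigma>\<close> at index \<open>q ^ D\<close>.\<close>
  define H where "H = real (D * E * J)"
  \<comment> \<open>Oscillations at index \<open>q ^ B\<close> are of smaller order than the level \<open>q powr (- H)\<close> reached by \<open>f\<close>.\<close>
  obtain B :: nat where B: "H / \<beta>0 < real B" using reals_Archimedean2 by blast
  have "H / \<beta>0 \<ge> 0" using C_const by (simp add: H_def)
  with B have "B \<ge> 1" by (cases B) auto
  \<comment> \<open>The lower bound for \<open>chi0\<close> is of the order of \<open>q powr (- H * \<rho>R)\<close> times the duration \<open>q powr (- B)\<close>.\<close>
  obtain A :: nat where A: "H * \<rho>R + real B < real A" using reals_Archimedean2 by blast
  have "H * \<rho>R \<ge> 0" using R_bound(1) by (simp add: H_def)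
  with A have "A \<ge> 1" by (cases A) auto

  define I where "I \<xi> n = increment_event M T X \<tau> J c0 \<alpha> \<xi> (1 / 2) n" for \<xi> n
  define O' where "O' n = {\<omega>\<in>space M. path_osc T Xhat X n \<omega> \<ge> ereal (real n powr (- \<beta>0))}" for n
  define bad where "bad q = ((\<Union>\<xi>\<in>\<Xi>. space M - I \<xi> (q ^ D)) \<union> O' q) \<union> O' (q ^ B)" for q
  define b where "b = (\<lambda>q. ((\<Sum>\<xi>\<in>\<Xi>. 1 - prob (I \<xi> (q ^ D))) + prob (O' q)) + prob (O' (q ^ B)))"
  have rapid_O: "(\<lambda>n. prob (O' n)) \<in> rapid_seqs" using C by (simp add: O'_def)
  have "(\<lambda>q. 1 - prob (I \<xi> (q ^ D))) \<in> rapid_seqs" if "\<xi> \<in> \<Xi>" for \<xi>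
    using rapid_seqs_power[OF N1_iii[OF \<Xi>(2)[OF that], of "1 / 2"] \<open>D \<ge> 1\<close>] by (simp add: I_def)
  then have "(\<lambda>q. \<Sum>\<xi>\<in>\<Xi>. 1 - prob (I \<xi> (q ^ D))) \<in> rapid_seqs"
    using rapid_seqs_sum[of \<Xi> "\<lambda>\<xi> q. 1 - prob (I \<xi> (q ^ D))"] \<Xi>(1) by simp
  from rapid_seqs_add[OF rapid_seqs_add[OF this rapid_O] rapid_seqs_power[OF rapid_O \<open>B \<ge> 1\<close>]]
  have rapid: "b \<in> rapid_seqs" by (simp add: b_def)
  have sets_I: "I \<xi> (q ^ D) \<in> sets M" if "\<xi> \<in> \<Xi>" "q \<ge> 1" for \<xi> q
    unfolding I_def by (rule N1_iii_meas[OF \<Xi>(2)[OF that(1)]]) (use that(2) in auto)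
  have sets_O: "O' n \<in> sets M" if "n \<ge> 1" for n
    unfolding O'_def by (rule C_meas[OF that])
  have bad: "bad q \<in> sets M" "prob (bad q) \<le> b q" if "q \<ge> 1" for q
  proof -
    have "q ^ B \<ge> 1" using that by simp
    note O = sets_O[OF that] sets_O[OF this]
    have U: "(\<Union>\<xi>\<in>\<Xi>. space M - I \<xi> (q ^ D)) \<in> sets M"
      using \<Xi>(1) sets_I[OF _ that] by (intro sets.finite_UN) auto
    show "bad q \<in> sets M" using U O unfolding bad_def by (intro sets.Un)
    have "prob (\<Union>\<xi>\<in>\<Xi>. space M - I \<xi> (q ^ D)) \<le> (\<Sum>\<xi>\<in>\<Xi>. prob (space M - I \<xi> (q ^ D)))"
      using \<Xi>(1) sets_I[OF _ that] by (intro finite_measure_subadditive_finite) auto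
    also have "\<dots> = (\<Sum>\<xi>\<in>\<Xi>. 1 - prob (I \<xi> (q ^ D)))"
      using sets_I[OF _ that] by (intro sum.cong prob_compl refl)
    finally show "prob (bad q) \<le> b q"
      using measure_Un_le[OF sets.Un[OF U O(1)] O(2)] measure_Un_le[OF U O(1)]
      unfolding bad_def b_def by linarith
  qed

  have "\<forall>\<^sub>F q in sequentially. real q powr (- \<beta>0) < r / 3 * real q powr (- 0)"
    using r C_const by (intro eventually_powr_dominated) auto
  moreover have "\<forall>\<^sub>F q in sequentially. real q powr (- 1) < (T - T') / 3 * real q powr (- 0)"
    using T'(2) by (intro eventually_powr_dominated) auto
  \<comment> \<open>Dividing by \<open>K + 1\<close> covers the Lipschitz constant \<open>0\<close>.\<close>
  moreover have "\<forall>\<^sub>F q in sequentially. real q powr (- (real B * \<beta>0)) < c / 2 / (K + 1) * real q powr (- H)"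
    using B c C_const \<open>K \<ge> 0\<close> by (intro eventually_powr_dominated) (auto simp: pos_divide_less_eq)
  moreover have "\<forall>\<^sub>F q in sequentially.
      real q powr (- real A) < (c / 2) powr \<rho>R * real q powr (- (H * \<rho>R + real B))"
    using A c by (intro eventually_powr_dominated) auto
  ultimately have "\<forall>\<^sub>F q in sequentially.
      prob {\<omega>\<in>space M. chi0 T X Q \<Theta> \<theta>s \<omega> \<le> ennreal (1 / real q ^ A)} \<le> b q"
    using eventually_at_power[OF E \<open>D \<ge> 1\<close>] eventually_ge_at_top[of 1]
  proof eventually_elim
    case (elim q)
    have q: "q \<ge> 1" "real q > 0" using elim by auto
    define \<delta> where "\<delta> = real q powr (- \<beta>0)"
    define \<delta>' where "\<delta>' = real (q ^ B) powr (- \<beta>0)"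
    define \<sigma> where "\<sigma> = 1 / real (q ^ D) ^ E"
    have \<delta>: "3 * \<delta> \<le> r" using elim(1) q by (simp add: \<delta>_def)
    have time: "T' + 3 / real q \<le> T" using elim(2) q by (simp add: powr_minus_divide field_simps)
    have \<delta>'q: "\<delta>' = real q powr (- (real B * \<beta>0))"
      using q by (simp add: \<delta>'_def powr_powr flip: powr_realpow)
    have \<sigma>q: "\<sigma> ^ J = real q powr (- H)"
    proof -
      have "real q powr H = real q ^ (D * E * J)" unfolding H_def by (rule powr_realpow[OF q(2)])
      then show ?thesis by (simp add: \<sigma>_def powr_minus_divide power_one_over flip: power_mult)
    qed
    have \<sigma>: "0 < \<sigma>" "\<sigma> \<le> 1" using q by (auto simp: \<sigma>_def)
    have N: "q ^ B \<ge> q" using q \<open>B \<ge> 1\<close> by (intro self_le_power) auto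
    have \<delta>'\<delta>: "\<delta>' \<le> \<delta>"
      unfolding \<delta>_def \<delta>'_def using N q C_const by (intro powr_mono2') (auto simp del: of_nat_power)
    have K\<delta>': "K * \<delta>' \<le> c / 2 * \<sigma> ^ J"
    proof -
      have "K * \<delta>' \<le> (K + 1) * \<delta>'" by (simp add: \<delta>'_def mult_right_mono)
      also have "\<dots> \<le> (K + 1) * (c / 2 / (K + 1) * \<sigma> ^ J)"
        using elim(3) \<open>K \<ge> 0\<close> unfolding \<delta>'q \<sigma>q by (intro mult_left_mono) auto
      also have "\<dots> = c / 2 * \<sigma> ^ J" using \<open>K \<ge> 0\<close> by (simp add: divide_simps)
      finally show ?thesis .
    qed
    have window: "real (q ^ D) powr (- c0) \<le> 1 / real q"
    proof -
      have "real (q ^ D) powr (- c0) = real q powr (- (real D * c0))"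
        using q by (simp add: powr_powr flip: powr_realpow)
      also have "\<dots> \<le> real q powr (- 1)" using Dc q by (intro powr_mono) auto
      finally show ?thesis using q by (simp add: powr_minus_divide)
    qed
    have gt: "1 / real q ^ A < (c / 2 * \<sigma> ^ J) powr \<rho>R * (1 / real (q ^ B))"
    proof -
      have "1 / real q ^ A = real q powr (- real A)" using q by (simp add: powr_minus_divide powr_realpow)
      also have "\<dots> < (c / 2) powr \<rho>R * real q powr (- (H * \<rho>R + real B))" by (rule elim(4))
      also have "real q powr (- (H * \<rho>R + real B)) = real q powr (- (H * \<rho>R)) * real q powr (- real B)"
        by (simp flip: powr_add)
      also have "real q powr (- (H * \<rho>R)) = (\<sigma> ^ J) powr \<rho>R" by (simp add: \<sigma>q powr_powr)
      also have "real q powr (- real B) = 1 / real (q ^ B)" using q by (simp add: powr_minus_divide powr_realpow)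
      finally show ?thesis using c \<sigma>(1) powr_mult[of "c / 2" "\<sigma> ^ J" \<rho>R] by simp
    qed
    have good: "\<omega> \<in> bad q" if \<omega>: "\<omega> \<in> space M" "\<tau> \<omega> \<le> T'" "X (\<tau> \<omega>) \<omega> \<in> X0"
      and small: "chi0 T X Q \<Theta> \<theta>s \<omega> \<le> ennreal (1 / real q ^ A)" for \<omega>
    proof (rule ccontr)
      assume nb: "\<omega> \<notin> bad q"
      have "ennreal ((c / 2 * \<sigma> ^ J) powr \<rho>R * (1 / real (q ^ B))) \<le> chi0 T X Q \<Theta> \<theta>s \<omega>"
      proof (rule chi0_ge_on_good_path[where n = "q ^ D" and \<epsilon> = "1 / 2" and q = q and \<delta> = \<delta> and \<delta>' = \<delta>'
            and K = K and \<Xi> = \<Xi> and r = r and f = f and x = "X (\<tau> \<omega>) \<omega>"])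
        show "\<omega> \<in> increment_event M T X \<tau> J c0 \<alpha> \<xi> (1 / 2) (q ^ D)" if "\<xi> \<in> \<Xi>" for \<xi>
          using nb that \<omega>(1) by (auto simp: bad_def I_def)
        show "path_osc T Xhat X q \<omega> < ereal \<delta>" "path_osc T Xhat X (q ^ B) \<omega> < ereal \<delta>'"
          using nb \<omega>(1) by (auto simp: bad_def O'_def \<delta>_def \<delta>'_def not_le)
        show "0 \<le> \<tau> \<omega>" using N1_iii_\<tau>(2)[OF \<omega>(1)] by simp
        show "\<tau> \<omega> + 3 / real q \<le> T" using time \<omega>(2) by simp
        show "\<sigma> \<le> \<bar>real (q ^ D) powr (- \<alpha> i) - real (q ^ D) powr (- \<alpha> j)\<bar>"
          if "i \<le> J" "j \<le> J" "i \<noteq> j" for i j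
          using elim(5) that unfolding \<sigma>_def by blast
        show "ball (X (\<tau> \<omega>) \<omega>) r \<subseteq> Xhat" by (rule ball[OF \<omega>(3)])
        show "\<exists>\<xi>\<in>\<Xi>. large_on_spread J (\<lambda>x. f x \<theta>) \<xi> r c (X (\<tau> \<omega>) \<omega>)" if "\<theta> \<in> \<Theta>" for \<theta>
          by (rule large[OF \<omega>(3) that])
      qed (use q window \<delta> \<delta>'\<delta> K\<delta>' N r \<sigma> c R_bound lip in auto)
      then have "ennreal ((c / 2 * \<sigma> ^ J) powr \<rho>R * (1 / real (q ^ B))) \<le> ennreal (1 / real q ^ A)"
        using small by (rule order_trans)
      then have "(c / 2 * \<sigma> ^ J) powr \<rho>R * (1 / real (q ^ B)) \<le> 1 / real q ^ A"
        by (simp only: ennreal_le_iff zero_le_divide_1_iff zero_le_power of_nat_0_le_iff)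
      with gt show False by linarith
    qed
    have "prob {\<omega>\<in>space M. chi0 T X Q \<Theta> \<theta>s \<omega> \<le> ennreal (1 / real q ^ A)} \<le> prob (bad q)"
    proof (rule finite_measure_mono_AE[OF _ bad(1)[OF q(1)]])
      show "AE \<omega> in M. \<omega> \<in> {\<omega>\<in>space M. chi0 T X Q \<Theta> \<theta>s \<omega> \<le> ennreal (1 / real q ^ A)} \<longrightarrow> \<omega> \<in> bad q"
        using AE_\<tau> AE_X0 by eventually_elim (use good in auto)
    qed
    also have "\<dots> \<le> b q" by (rule bad(2)[OF q(1)])
    finally show ?case .
  qed
  then show ?thesis by (rule rapid_tail_from_powers[OF meas_chi0 \<open>A \<ge> 1\<close> rapid])
qed

end
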